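(* Suppose that $\mathrm{PCSP}(\mathbb K_3,\mathbb K_\ell)$ is NP-hard for all $\ell\geq 3$. Let $\mathbb C$ be a structure and let $\mathscr G\leq\mathrm{Aut}(\mathbb C)$ be an oligomorphic subgroup. If $\mathrm{Pol}(\mathbb C)$ does not satisfy the 6-ary Siggers identity modulo $\overline{\mathscr G}$, then $\mathrm{CSP}(\mathbb C)$ is NP-hard.
   Context: All structures are relational, at most countable, with finite signature. $\mathbb K_r$ is the complete (loopless) graph on $r$ vertices. For structures with a homomorphism $\mathbb A\to\mathbb B$, $\mathrm{PCSP}(\mathbb A,\mathbb B)$ is the promise problem of deciding whether a given finite $\mathbb X$ admits a homomorphism to $\mathbb A$ (yes) or no homomorphism to $\mathbb B$ (no); $\mathrm{CSP}(\mathbb C)=\mathrm{PCSP}(\mathbb C,\mathbb C)$. A permutation group $\mathscr G$ on $C$ is oligomorphic if it has finitely many orbits on $C^k$ for every $k\ge1$. $\overline{\mathscr G}$ is the closure of $\mathscr G$ in $C^C$ in the topology of pointwise convergence. $\mathrm{Pol}(\mathbb C)$ is the set of all homomorphisms $\mathbb C^n\to\mathbb C$, $n\ge1$. The 6-ary Siggers identity is $s(x,y,x,z,y,z)\approx s(y,x,z,x,z,y)$; $\mathrm{Pol}(\mathbb C)$ satisfies it modulo $\overline{\mathscr G}$ if there are a 6-ary $s\in\mathrm{Pol}(\mathbb C)$ and $u,v\in\overline{\mathscr G}$ with $u(s(x,y,x,z,y,z))=v(s(y,x,z,x,z,y))$ for all $x,y,z\in C$. *)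

theory Defs
  imports
    "HOL-Algebra.Bij"
    "HOL-Analysis.Function_Topology"
    "HOL-Computational_Algebra.Polynomial"
begin

section \<open>Relational structures\<close>

text \<open>
  The signature is the finite list of the arities of its symbols; \<open>rel A i\<close> interprets the
  \<open>i\<close>-th symbol and is irrelevant for \<open>i \<ge> length (signature A)\<close>. Tuples are lists.
\<close>

record 'a rel_struct =
  universe :: "'a set"
  signature :: "nat list"
  rel :: "nat \<Rightarrow> 'a list set"

definition tuples :: "nat \<Rightarrow> 'a set \<Rightarrow> 'a list set" where
  "tuples k S = {t. length t = k \<and> set t \<subseteq> S}"

definition rel_structure :: "'a rel_struct \<Rightarrow> bool" where
  "rel_structure A \<longleftrightarrow> countable (universe A) \<and>
     (\<forall>i<length (signature A). rel A i \<subseteq> tuples (signature A ! i) (universe A))"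

text \<open>Homomorphisms are extensional functions, so that they form a subset of \<open>B\<^sup>A\<close>.\<close>

definition homs :: "'a rel_struct \<Rightarrow> 'b rel_struct \<Rightarrow> ('a \<Rightarrow> 'b) set" where
  "homs A B = {h \<in> universe A \<rightarrow>\<^sub>E universe B. signature A = signature B \<and>
     (\<forall>i<length (signature A). \<forall>t\<in>rel A i. map h t \<in> rel B i)}"

definition Aut :: "'a rel_struct \<Rightarrow> ('a \<Rightarrow> 'a) set" where
  "Aut A = {f \<in> Bij (universe A).
     f \<in> homs A A \<and> restrict (inv_into (universe A) f) (universe A) \<in> homs A A}"

text \<open>
  Elements of the power are lists of length \<open>n\<close>. A tuple \<open>ts\<close> of such lists is related iff each
  of its \<open>n\<close> projections is.
\<close>

definition power_struct :: "nat \<Rightarrow> 'a rel_struct \<Rightarrow> 'a list rel_struct" where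
  "power_struct n A =
     \<lparr>universe = tuples n (universe A),
      signature = signature A,
      rel = (\<lambda>i. {ts \<in> tuples (signature A ! i) (tuples n (universe A)).
                   \<forall>j<n. map (\<lambda>t. t ! j) ts \<in> rel A i})\<rparr>"

definition Pol :: "nat \<Rightarrow> 'a rel_struct \<Rightarrow> ('a list \<Rightarrow> 'a) set" where
  "Pol n A = homs (power_struct n A) A"

definition K :: "nat \<Rightarrow> nat rel_struct" where
  "K r = \<lparr>universe = {..<r}, signature = [2],
          rel = (\<lambda>_. {[x, y] | x y. x < r \<and> y < r \<and> x \<noteq> y})\<rparr>"


section \<open>Permutation groups\<close>

definition oligomorphic :: "'a set \<Rightarrow> ('a \<Rightarrow> 'a) set \<Rightarrow> bool" where
  "oligomorphic S G \<longleftrightarrow> (\<forall>k\<ge>1. finite {{map g t | g. g \<in> G} | t. t \<in> tuples k S})"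

definition pointwise_closure :: "'a set \<Rightarrow> ('a \<Rightarrow> 'a) set \<Rightarrow> ('a \<Rightarrow> 'a) set" where
  "pointwise_closure S G = product_topology (\<lambda>_. discrete_topology S) S closure_of G"

definition siggers_modulo :: "'a rel_struct \<Rightarrow> ('a \<Rightarrow> 'a) set \<Rightarrow> bool" where
  "siggers_modulo A H \<longleftrightarrow> (\<exists>s\<in>Pol 6 A. \<exists>u\<in>H. \<exists>v\<in>H.
     \<forall>x\<in>universe A. \<forall>y\<in>universe A. \<forall>z\<in>universe A.
       u (s [x, y, x, z, y, z]) = v (s [y, x, z, x, z, y]))"


section \<open>Polynomial time on Turing machines\<close>

text \<open>
  Deterministic machines with finitely many two-way infinite tapes. States and tape symbols are
  initial segments of the naturals; the start state is 0, the blank is 0, and the bits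
  \<open>False\<close>, \<open>True\<close> are written 1, 2. The machine halts when no transition is specified.
\<close>

datatype move = Left | Stay | Right

record machine =
  num_tapes :: nat
  num_states :: nat
  num_symbols :: nat
  delta :: "nat \<Rightarrow> nat list \<Rightarrow> (nat \<times> (nat \<times> move) list) option"

definition turing_machine :: "machine \<Rightarrow> bool" where
  "turing_machine M \<longleftrightarrow> 1 \<le> num_tapes M \<and> 1 \<le> num_states M \<and> 3 \<le> num_symbols M \<and>
     (\<forall>q<num_states M. \<forall>ss\<in>tuples (num_tapes M) {..<num_symbols M}. \<forall>q' as.
        delta M q ss = Some (q', as) \<longrightarrow>
          q' < num_states M \<and> length as = num_tapes M \<and> (\<forall>(a, d)\<in>set as. a < num_symbols M))"

text \<open>A tape is its contents together with the head position.\<close>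

type_synonym tape = "(int \<Rightarrow> nat) \<times> int"
type_synonym config = "nat \<times> tape list"

fun read :: "tape \<Rightarrow> nat" where
  "read (c, h) = c h"

fun offset :: "move \<Rightarrow> int" where
  "offset Left = - 1"
| "offset Stay = 0"
| "offset Right = 1"

fun act :: "nat \<times> move \<Rightarrow> tape \<Rightarrow> tape" where
  "act (a, d) (c, h) = (c(h := a), h + offset d)"

definition step :: "machine \<Rightarrow> config rel" where
  "step M = {((q, ts), (q', map2 act as ts)) | q ts q' as.
     delta M q (map read ts) = Some (q', as)}"

definition halted :: "machine \<Rightarrow> config \<Rightarrow> bool" where
  "halted M c \<longleftrightarrow> delta M (fst c) (map read (snd c)) = None"

definition word_tape :: "bool list \<Rightarrow> tape" where
  "word_tape w =
     (\<lambda>i. if 0 \<le> i \<and> i < int (length w) then (if w ! nat i then 2 else 1) else 0, 0)"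

definition init_config :: "machine \<Rightarrow> bool list \<Rightarrow> config" where
  "init_config M w = (0, word_tape w # replicate (num_tapes M - 1) (word_tape []))"

text \<open>
  Input and output are on the first tape. On halting, that tape holds precisely the output, with
  the head on its first symbol; the contents of the other tapes do not matter.
\<close>

definition computes_within :: "machine \<Rightarrow> bool list \<Rightarrow> nat \<Rightarrow> bool list \<Rightarrow> bool" where
  "computes_within M x T y \<longleftrightarrow> (\<exists>t\<le>T. \<exists>c. (init_config M x, c) \<in> step M ^^ t \<and>
     halted M c \<and> snd c ! 0 = word_tape y)"

definition poly_time :: "(bool list \<Rightarrow> bool list) \<Rightarrow> bool" where
  "poly_time f \<longleftrightarrow> (\<exists>M (p :: nat poly). turing_machine M \<and>
     (\<forall>x. computes_within M x (poly p (length x)) (f x)))"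


section \<open>NP and NP-hardness\<close>

text \<open>The first component is made self-delimiting by doubling.\<close>

definition pair_word :: "bool list \<Rightarrow> bool list \<Rightarrow> bool list" where
  "pair_word x w = concat (map (\<lambda>b. [True, b]) x) @ [False] @ w"

definition NP :: "bool list set set" where
  "NP = {L. \<exists>V (p :: nat poly). poly_time V \<and>
     (\<forall>x. x \<in> L \<longleftrightarrow> (\<exists>w. length w \<le> poly p (length x) \<and> V (pair_word x w) = [True]))}"

text \<open>
  A promise problem is the pair of its yes-instances and its no-instances; hardness is with
  respect to polynomial-time many-one reductions.
\<close>

type_synonym promise_problem = "bool list set \<times> bool list set"

definition NP_hard :: "promise_problem \<Rightarrow> bool" where
  "NP_hard P \<longleftrightarrow> (\<forall>L\<in>NP. \<exists>f. poly_time f \<and>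
     (\<forall>x. (x \<in> L \<longrightarrow> f x \<in> fst P) \<and> (x \<notin> L \<longrightarrow> f x \<in> snd P)))"


section \<open>Constraint satisfaction problems\<close>

text \<open>
  A finite structure with universe \<open>{..<n}\<close> is given by \<open>n\<close> followed by a list, in arbitrary
  order, of all its facts: the index of a relation symbol and the entries of a tuple in that
  relation. All numbers are in unary, which costs only a polynomial factor as they are bounded by
  \<open>n\<close> or by the fixed size of the signature.
\<close>

definition nat_word :: "nat \<Rightarrow> bool list" where
  "nat_word n = replicate n True @ [False]"

definition fact_word :: "nat \<times> nat list \<Rightarrow> bool list" where
  "fact_word = (\<lambda>(i, t). concat (map nat_word (i # t)))"

definition encodes :: "bool list \<Rightarrow> nat rel_struct \<Rightarrow> bool" where
  "encodes w X \<longleftrightarrow> rel_structure X \<and> (\<exists>n fs. universe X = {..<n} \<and>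
     set fs = {(i, t). i < length (signature X) \<and> t \<in> rel X i} \<and>
     w = nat_word n @ concat (map fact_word fs))"

definition PCSP :: "'a rel_struct \<Rightarrow> 'b rel_struct \<Rightarrow> promise_problem" where
  "PCSP A B =
     ({w. \<exists>X. encodes w X \<and> signature X = signature A \<and> homs X A \<noteq> {}},
      {w. \<exists>X. encodes w X \<and> signature X = signature B \<and> homs X B = {}})"

definition CSP :: "'a rel_struct \<Rightarrow> promise_problem" where
  "CSP A = PCSP A A"

end

theory Submission
  imports Defs
begin


text \<open>
  By compactness and oligomorphicity there is a finite \<open>D \<subseteq> C\<close> without a partial polymorphism
  \<open>f : D\<^sup>6 \<rightarrow> C\<close> such that \<open>f (x, y, x, z, y, z) = g (f (y, x, z, x, z, y))\<close> on \<open>D\<^sup>3\<close> for a single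
  \<open>g \<in> G\<close>. Given a graph, take for every vertex one variable for each triple from \<open>D\<close> and for every
  edge a copy of the substructure of \<open>C\<^sup>6\<close> on \<open>D\<^sup>6\<close>, glued to its two ends along the two sides of the
  Siggers identity. A 3-colouring of the graph maps the copy belonging to an edge to \<open>C\<close> by one of
  the six projections. Conversely, a homomorphism of the resulting instance to \<open>C\<close> colours each
  vertex by the \<open>G\<close>-orbit of its tuple of values, and by the choice of \<open>D\<close> the ends of an edge lie in
  different orbits. There are finitely many orbits, say at most \<open>l\<close>, so this reduces
  \<open>PCSP (K 3) (K l)\<close> to \<open>CSP C\<close>. The reduction reads the edges one by one and writes a fixed template
  for each, which a Turing machine can do in polynomial time.
\<close>

section \<open>Composition of polynomial-time functions\<close>

text \<open>The condition on \<open>D\<close> asks for one \<open>g\<close> for all triples, because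
  it then says that two tuples of values lie in a common \<open>G\<close>-orbit, and this is all
  that a colour records. The number \<open>l\<close> depends on \<open>C\<close> and
  \<open>D\<close> but not on the graph; as nothing bounds it uniformly, hardness is assumed for
  every \<open>l\<close>. Literally, the gluing is a quotient of a disjoint union, which is awkward
  to write down while reading a word. Instead every variable gets a number that is linear in the
  ends and the index of its edge, so that glued variables have equal numbers by construction.
  Numbers that name no variable stay behind as isolated elements, and a homomorphism may send these
  anywhere. The announced size therefore only has to be an upper bound, for which \<open>B\<close>
  times the input length is taken. Hardness is defined by Turing machines, so the template expansion
  needs an actual machine with a time bound, and reductions have to be composed on that
  level.\<close>

lemma poly_nat_mono: "x \<le> y \<Longrightarrow> poly (p :: nat poly) x \<le> poly p y"
  by (induction p) (auto intro!: add_mono mult_mono)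

lemma relpow_simulation:
  assumes "\<And>c c'. I c \<Longrightarrow> (c, c') \<in> R \<Longrightarrow> (f c, f c') \<in> S \<and> I c'"
    and "(c, c') \<in> R ^^ t" and "I c"
  shows "(f c, f c') \<in> S ^^ t \<and> I c'"
  using assms(2)
proof (induction t arbitrary: c')
  case 0
  then show ?case using assms(3) by simp
next
  case (Suc t)
  then obtain d where "(c, d) \<in> R ^^ t" "(d, c') \<in> R" by auto
  then show ?case using Suc.IH assms(1) by auto
qed

definition idle :: "nat list \<Rightarrow> (nat \<times> move) list" where
  "idle ss = map (\<lambda>s. (s, Stay)) ss"

lemma length_idle [simp]: "length (idle ss) = length ss"
  by (simp add: idle_def)

lemma act_read_Stay [simp]: "act (read t, Stay) t = t"
  by (cases t) simp

lemma map2_act_idle [simp]: "map2 act (idle (map read ts)) ts = ts"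
  by (induction ts) (simp_all add: idle_def)

section \<open>Alphabets, head positions and the length of outputs\<close>

definition valid_config :: "machine \<Rightarrow> config \<Rightarrow> bool" where
  "valid_config M c \<longleftrightarrow> fst c < num_states M \<and> length (snd c) = num_tapes M \<and>
     (\<forall>t\<in>set (snd c). \<forall>i. fst t i < num_symbols M)"

lemma valid_config_read:
  assumes "valid_config M c"
  shows "map read (snd c) \<in> tuples (num_tapes M) {..<num_symbols M}"
  using assms unfolding valid_config_def tuples_def by (force elim!: read.elims)

text \<open>\<open>turing_machine\<close> restricts \<open>delta\<close> on words over the alphabet
  only; its guarantees reach a run through this invariant.\<close>

lemma valid_config_step:
  assumes "turing_machine M" and "valid_config M c" and "(c, c') \<in> step M"
  obtains as where "delta M (fst c) (map read (snd c)) = Some (fst c', as)"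
    and "snd c' = map2 act as (snd c)" and "length as = num_tapes M"
    and "valid_config M c'"
proof -
  obtain as where d: "delta M (fst c) (map read (snd c)) = Some (fst c', as)"
    and c': "snd c' = map2 act as (snd c)"
    using assms(3) unfolding step_def by auto
  have as: "fst c' < num_states M" "length as = num_tapes M"
    "\<forall>(a, d)\<in>set as. a < num_symbols M"
    using assms(1,2) d valid_config_read[OF assms(2)]
    unfolding turing_machine_def valid_config_def by metis+
  have "fst t i < num_symbols M" if "t \<in> set (snd c')" for t i
  proof -
    obtain x s where "(x, s) \<in> set (zip as (snd c))" "t = act x s"
      using \<open>t \<in> set (snd c')\<close> c' by auto
    moreover from this have "x \<in> set as" "s \<in> set (snd c)"
      by (auto dest: set_zip_leftD set_zip_rightD)
    ultimately show ?thesis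
      using as(3) assms(2) unfolding valid_config_def by (cases x; cases s) auto
  qed
  then have "valid_config M c'"
    using as c' assms(2) by (auto simp: valid_config_def)
  then show thesis using that d c' as(2) by blast
qed

lemma valid_config_init:
  assumes "turing_machine M"
  shows "valid_config M (init_config M x)"
  using assms unfolding turing_machine_def valid_config_def init_config_def word_tape_def
  by auto

text \<open>The head moves by at most one cell per step, so the first \<open>t\<close> steps write
  only to cells left of \<open>t\<close>.\<close>

lemma run_locality:
  assumes M: "turing_machine M" and "(init_config M x, c) \<in> step M ^^ t"
  shows "valid_config M c \<and> \<bar>snd (snd c ! 0)\<bar> \<le> int t \<and>
    (\<forall>i\<ge>int t. fst (snd c ! 0) i = fst (word_tape x) i)"
  using assms(2)
proof (induction t arbitrary: c)
  case 0
  then show ?case using valid_config_init[OF M] by (auto simp: init_config_def word_tape_def)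
next
  case (Suc t)
  then obtain c0 where c0: "(init_config M x, c0) \<in> step M ^^ t" "(c0, c) \<in> step M" by auto
  note IH = Suc.IH[OF c0(1)]
  obtain as where as: "snd c = map2 act as (snd c0)" "length as = num_tapes M" "valid_config M c"
    using valid_config_step[OF M _ c0(2)] IH by metis
  have "1 \<le> num_tapes M" using M by (simp add: turing_machine_def)
  then have "snd c ! 0 = act (as ! 0) (snd c0 ! 0)"
    using as IH unfolding valid_config_def by (subst as(1), subst nth_map) auto
  moreover obtain a d where "as ! 0 = (a, d)" by fastforce
  moreover obtain f h where "snd c0 ! 0 = (f, h)" by fastforce
  moreover have "\<bar>offset d\<bar> \<le> 1" by (cases d) auto
  ultimately show ?case using IH as(3) by auto
qed

text \<open>The cell at \<open>length x + T\<close> is blank in the input and out of reach, whereas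
  a longer output would fill it. The bound controls the input length of the second machine in a
  composition.\<close>

lemma output_length:
  assumes "turing_machine M" and "computes_within M x T y"
  shows "length y \<le> length x + T"
proof (rule ccontr)
  assume len: "\<not> ?thesis"
  obtain t c where tc: "t \<le> T" "(init_config M x, c) \<in> step M ^^ t" "snd c ! 0 = word_tape y"
    using assms(2) unfolding computes_within_def by auto
  have "fst (word_tape y) (int (length x + T)) = fst (word_tape x) (int (length x + T))"
    using run_locality[OF assms(1) tc(2)] tc by simp
  then show False using len by (auto simp: word_tape_def split: if_splits)
qed

text \<open>
  The tapes of the composite are those of \<open>M\<close> followed by all but the first tape of \<open>N\<close>. The
  guards on the symbols matter because \<open>delta\<close> is unconstrained outside the alphabet.
\<close>

definition machine_comp :: "machine \<Rightarrow> machine \<Rightarrow> machine" where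
  "machine_comp M N = \<lparr>num_tapes = num_tapes M + (num_tapes N - 1),
     num_states = num_states M + num_states N,
     num_symbols = max (num_symbols M) (num_symbols N),
     delta = (\<lambda>q ss.
       if q < num_states M then
         if set (take (num_tapes M) ss) \<subseteq> {..<num_symbols M} then
           (case delta M q (take (num_tapes M) ss) of
              None \<Rightarrow> Some (num_states M, idle ss)
            | Some (q', as) \<Rightarrow> Some (q', as @ idle (drop (num_tapes M) ss)))
         else None
       else
         if set (hd ss # drop (num_tapes M) ss) \<subseteq> {..<num_symbols N} then
           map_option (\<lambda>(q', as). (num_states M + q',
               hd as # idle (take (num_tapes M - 1) (tl ss)) @ tl as))
             (delta N (q - num_states M) (hd ss # drop (num_tapes M) ss))
         else None)\<rparr>"

lemma turing_machine_comp:
  assumes M: "turing_machine M" and N: "turing_machine N"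
  shows "turing_machine (machine_comp M N)"
proof -
  let ?k = "num_tapes M" and ?l = "num_tapes N" and ?n = "num_states M"
  have kl: "1 \<le> ?k" "1 \<le> ?l" and sz: "1 \<le> num_states M" "1 \<le> num_states N" "3 \<le> num_symbols M"
    using M N by (auto simp: turing_machine_def)
  have "q' < ?n + num_states N \<and> length as = ?k + (?l - 1) \<and>
      (\<forall>(a, d)\<in>set as. a < max (num_symbols M) (num_symbols N))"
    if q: "q < ?n + num_states N"
      and ss: "length ss = ?k + (?l - 1)" "set ss \<subseteq> {..<max (num_symbols M) (num_symbols N)}"
      and d: "delta (machine_comp M N) q ss = Some (q', as)" for q ss q' as
  proof (cases "q < ?n")
    case True
    then have sub: "set (take ?k ss) \<subseteq> {..<num_symbols M}"
      using d by (auto simp: machine_comp_def split: if_splits)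
    show ?thesis
    proof (cases "delta M q (take ?k ss)")
      case None
      then have "q' = ?n" "as = idle ss"
        using d True sub by (simp_all add: machine_comp_def)
      then show ?thesis using ss sz by (auto simp: idle_def)
    next
      case (Some r)
      obtain q1 as1 where r: "r = (q1, as1)" by fastforce
      have "q' = q1" "as = as1 @ idle (drop ?k ss)"
        using d True sub Some r by (simp_all add: machine_comp_def)
      moreover have "take ?k ss \<in> tuples ?k {..<num_symbols M}"
        using sub ss by (simp add: tuples_def)
      then have "q1 < ?n \<and> length as1 = ?k \<and> (\<forall>(a, d)\<in>set as1. a < num_symbols M)"
        using M True Some r unfolding turing_machine_def by metis
      moreover have "\<forall>(a, d)\<in>set (idle (drop ?k ss)). a < max (num_symbols M) (num_symbols N)"
        using ss(2) by (auto simp: idle_def dest: in_set_dropD)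
      ultimately show ?thesis using ss by fastforce
    qed
  next
    case False
    let ?rs = "hd ss # drop ?k ss"
    have sub: "set ?rs \<subseteq> {..<num_symbols N}"
      using d False by (auto simp: machine_comp_def split: if_splits)
    obtain q1 as1 where r: "delta N (q - ?n) ?rs = Some (q1, as1)"
      "q' = ?n + q1" "as = hd as1 # idle (take (?k - 1) (tl ss)) @ tl as1"
      using d False sub by (auto simp: machine_comp_def)
    have "?rs \<in> tuples ?l {..<num_symbols N}"
      using sub ss kl by (simp add: tuples_def)
    moreover have "q - ?n < num_states N" using q False by linarith
    ultimately have as1: "q1 < num_states N \<and> length as1 = ?l \<and> (\<forall>(a, d)\<in>set as1. a < num_symbols N)"
      using N r(1) unfolding turing_machine_def by metis
    then have "as1 \<noteq> []" using kl by auto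
    then have "set as1 = insert (hd as1) (set (tl as1))" by (metis list.exhaust_sel list.simps(15))
    moreover have "\<forall>(a, d)\<in>set (idle (take (?k - 1) (tl ss))). a < max (num_symbols M) (num_symbols N)"
      using ss(2) by (cases ss) (auto simp: idle_def dest: in_set_takeD)
    ultimately have "\<forall>(a, d)\<in>set as. a < max (num_symbols M) (num_symbols N)"
      using as1 r(3) by fastforce
    then show ?thesis using as1 r ss kl by simp
  qed
  note delta = this
  have sizes: "num_tapes (machine_comp M N) = ?k + (?l - 1)"
    "num_states (machine_comp M N) = ?n + num_states N"
    "num_symbols (machine_comp M N) = max (num_symbols M) (num_symbols N)"
    by (simp_all add: machine_comp_def)
  show ?thesis
    unfolding turing_machine_def tuples_def sizes
    using kl sz by (intro conjI allI impI ballI; (elim CollectE conjE)?; (blast dest: delta | simp))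
qed

lemma machine_comp_step1:
  assumes M: "turing_machine M" and c: "valid_config M c" and s: "(c, c') \<in> step M"
  shows "((fst c, snd c @ bs), (fst c', snd c' @ bs)) \<in> step (machine_comp M N) \<and> valid_config M c'"
proof -
  obtain as where as: "delta M (fst c) (map read (snd c)) = Some (fst c', as)"
    "snd c' = map2 act as (snd c)" "length as = num_tapes M" "valid_config M c'"
    using valid_config_step[OF M c s] by metis
  have "set (map read (snd c)) \<subseteq> {..<num_symbols M}" "length (snd c) = num_tapes M"
    "fst c < num_states M"
    using valid_config_read[OF c] c by (auto simp: tuples_def valid_config_def)
  then have "delta (machine_comp M N) (fst c) (map read (snd c @ bs)) =
      Some (fst c', as @ idle (map read bs))"
    using as by (simp add: machine_comp_def)
  moreover have "snd c' @ bs = map2 act (as @ idle (map read bs)) (snd c @ bs)"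
    using as c by (simp add: valid_config_def zip_append)
  ultimately show ?thesis using as(4) unfolding step_def by blast
qed

lemma machine_comp_switch:
  assumes c: "valid_config M c" and h: "halted M c"
  shows "((fst c, snd c @ bs), (num_states M, snd c @ bs)) \<in> step (machine_comp M N)"
proof -
  have "set (map read (snd c)) \<subseteq> {..<num_symbols M}" "length (snd c) = num_tapes M"
    "fst c < num_states M"
    using valid_config_read[OF c] c by (auto simp: tuples_def valid_config_def)
  then have "delta (machine_comp M N) (fst c) (map read (snd c @ bs)) =
      Some (num_states M, idle (map read (snd c @ bs)))"
    using h by (simp add: machine_comp_def halted_def)
  then show ?thesis unfolding step_def using map2_act_idle[of "snd c @ bs"] by force
qed

text \<open>The shared tape stays in front; \<open>bs\<close> are the work tapes left behind by
  \<open>M\<close>, followed by the work tapes of \<open>N\<close>.\<close>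

definition second_config :: "machine \<Rightarrow> tape list \<Rightarrow> config \<Rightarrow> config" where
  "second_config M bs c = (num_states M + fst c, hd (snd c) # bs @ tl (snd c))"

lemma machine_comp_step2:
  assumes N: "turing_machine N" and c: "valid_config N c" and s: "(c, c') \<in> step N"
    and bs: "Suc (length bs) = num_tapes M"
  shows "(second_config M bs c, second_config M bs c') \<in> step (machine_comp M N) \<and> valid_config N c'"
proof -
  obtain as where as: "delta N (fst c) (map read (snd c)) = Some (fst c', as)"
    "snd c' = map2 act as (snd c)" "length as = num_tapes N" "valid_config N c'"
    using valid_config_step[OF N c s] by metis
  have *: "set (map read (snd c)) \<subseteq> {..<num_symbols N}" "length (snd c) = num_tapes N"
    using valid_config_read[OF c] c by (auto simp: tuples_def valid_config_def)
  have "1 \<le> num_tapes N" using N by (simp add: turing_machine_def)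
  then obtain t ts a as' where t: "snd c = t # ts" and a: "as = a # as'"
    using * as(3) by (metis length_0_conv list.exhaust not_one_le_zero)
  have drop: "drop (num_tapes M) (read t # map read bs @ map read ts) = map read ts"
    using bs by (metis drop_Suc_Cons append_eq_conv_conj length_map)
  have "delta (machine_comp M N) (fst (second_config M bs c)) (map read (snd (second_config M bs c))) =
      Some (fst (second_config M bs c'), a # idle (map read bs) @ as')"
    using as * t a bs by (simp add: machine_comp_def second_config_def drop flip: bs)
  moreover have "snd (second_config M bs c') =
      map2 act (a # idle (map read bs) @ as') (snd (second_config M bs c))"
    using as t a by (simp add: second_config_def zip_append)
  ultimately have "(second_config M bs c, second_config M bs c') \<in> step (machine_comp M N)"
    unfolding step_def by (cases "second_config M bs c", cases "second_config M bs c'") auto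
  then show ?thesis using as(4) by simp
qed

lemma machine_comp_halted:
  assumes c: "valid_config N c" and h: "halted N c"
    and bs: "Suc (length bs) = num_tapes M" and N: "turing_machine N"
  shows "halted (machine_comp M N) (second_config M bs c)"
proof -
  have "1 \<le> num_tapes N" using N by (simp add: turing_machine_def)
  then obtain t ts where t: "snd c = t # ts"
    using c by (metis length_0_conv list.exhaust not_one_le_zero valid_config_def)
  have drop: "drop (num_tapes M) (read t # map read bs @ map read ts) = map read ts"
    using bs by (metis drop_Suc_Cons append_eq_conv_conj length_map)
  then show ?thesis using h t
    by (simp add: halted_def machine_comp_def second_config_def)
qed

lemma computes_within_comp:
  assumes M: "turing_machine M" and N: "turing_machine N"
    and xy: "computes_within M x T y" and yz: "computes_within N y T' z"
  shows "computes_within (machine_comp M N) x (T + 1 + T') z"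
proof -
  let ?S = "step (machine_comp M N)"
  obtain t c where t: "t \<le> T" "(init_config M x, c) \<in> step M ^^ t" "halted M c"
    "snd c ! 0 = word_tape y"
    using xy unfolding computes_within_def by auto
  obtain t' c' where t': "t' \<le> T'" "(init_config N y, c') \<in> step N ^^ t'" "halted N c'"
    "snd c' ! 0 = word_tape z"
    using yz unfolding computes_within_def by auto
  have k: "1 \<le> num_tapes M" "1 \<le> num_tapes N" using M N by (auto simp: turing_machine_def)
  define bs where "bs = tl (snd c)"
  define es where "es = replicate (num_tapes N - 1) (word_tape [])"
  have vc: "valid_config M c" using run_locality[OF M t(2)] by simp
  then have len: "length (snd c) = num_tapes M" by (simp add: valid_config_def)
  have bs: "Suc (length bs) = num_tapes M" and c: "snd c = word_tape y # bs"
    using len k t(4) by (cases "snd c"; simp add: bs_def)+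
  have ic: "init_config (machine_comp M N) x = (fst (init_config M x), snd (init_config M x) @ es)"
    using k by (simp add: init_config_def machine_comp_def es_def flip: replicate_add)
  have "(init_config (machine_comp M N) x, (fst c, snd c @ es)) \<in> ?S ^^ t"
    unfolding ic
    using relpow_simulation[where f = "\<lambda>c. (fst c, snd c @ es)" and I = "valid_config M" and R = "step M",
        OF machine_comp_step1[OF M] t(2) valid_config_init[OF M]] by blast
  \<comment> \<open>The output convention leaves the head on the first symbol, so the halted first
    tape of \<open>M\<close> is already the start tape of \<open>N\<close>.\<close>
  moreover have "((fst c, snd c @ es), second_config M bs (init_config N y)) \<in> ?S"
    using machine_comp_switch[OF vc t(3), of es N] c
    by (simp add: second_config_def init_config_def es_def)
  moreover have "(second_config M bs (init_config N y), second_config M bs c') \<in> ?S ^^ t' \<and> valid_config N c'"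
    using relpow_simulation[where f = "second_config M bs" and I = "valid_config N" and R = "step N",
        OF machine_comp_step2[OF N _ _ bs] t'(2) valid_config_init[OF N]] by blast
  ultimately have run: "(init_config (machine_comp M N) x, second_config M bs c') \<in> ?S ^^ (Suc t + t')"
    and vc': "valid_config N c'"
    by (auto simp only: relpow_add relpow.simps intro: relcompI)
  have "snd c' \<noteq> []" using vc' k by (auto simp: valid_config_def)
  then have "snd (second_config M bs c') ! 0 = word_tape z"
    using t'(4) by (simp add: second_config_def hd_conv_nth)
  then show ?thesis
    unfolding computes_within_def
    using run machine_comp_halted[OF vc' t'(3) bs N] t(1) t'(1)
    by (intro exI[of _ "Suc t + t'"] exI[of _ "second_config M bs c'"] conjI) simp_all
qed

lemma poly_time_comp:
  assumes "poly_time f" and "poly_time g"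
  shows "poly_time (\<lambda>x. g (f x))"
proof -
  obtain M p where M: "turing_machine M" "\<And>x. computes_within M x (poly p (length x)) (f x)"
    using assms(1) unfolding poly_time_def by auto
  obtain N r where N: "turing_machine N" "\<And>x. computes_within N x (poly r (length x)) (g x)"
    using assms(2) unfolding poly_time_def by auto
  \<comment> \<open>The output of the first machine has length at most
    \<open>length x + poly p (length x)\<close>, whence the inner polynomial
    \<open>[:0, 1:] + p\<close>; the summand 1 pays for the switch.\<close>
  let ?p = "p + 1 + pcompose r ([:0, 1:] + p)"
  have "computes_within (machine_comp M N) x (poly ?p (length x)) (g (f x))" for x
  proof -
    have "length (f x) \<le> length x + poly p (length x)"
      using output_length[OF M(1) M(2)] .
    then have "poly p (length x) + 1 + poly r (length (f x)) \<le> poly ?p (length x)"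
      by (simp add: poly_pcompose poly_nat_mono)
    then show ?thesis
      using computes_within_comp[OF M(1) N(1) M(2) N(2), of x]
      unfolding computes_within_def by (meson order_trans)
  qed
  then show ?thesis
    using turing_machine_comp[OF M(1) N(1)] unfolding poly_time_def by blast
qed

lemma NP_hard_reduction:
  assumes "NP_hard P" and "poly_time g"
    and "\<And>w. w \<in> fst P \<Longrightarrow> g w \<in> fst Q" and "\<And>w. w \<in> snd P \<Longrightarrow> g w \<in> snd Q"
  shows "NP_hard Q"
  unfolding NP_hard_def
proof
  fix L :: "bool list set"
  assume "L \<in> NP"
  then obtain f where "poly_time f" "\<forall>x. (x \<in> L \<longrightarrow> f x \<in> fst P) \<and> (x \<notin> L \<longrightarrow> f x \<in> snd P)"
    using assms(1) unfolding NP_hard_def by blast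
  then show "\<exists>f. poly_time f \<and> (\<forall>x. (x \<in> L \<longrightarrow> f x \<in> fst Q) \<and> (x \<notin> L \<longrightarrow> f x \<in> snd Q))"
    using poly_time_comp[OF _ assms(2)] assms(3,4) by blast
qed


section \<open>Structured programs for Turing machines\<close>

text \<open>Actions and tests depend on the symbols under the heads only, so finitely many control
  states suffice to run a program.\<close>

datatype prog =
    Act nat "nat list \<Rightarrow> nat \<times> move"
  | Seq prog prog
  | Cond "nat list \<Rightarrow> bool" prog prog
  | Loop "nat list \<Rightarrow> bool" prog

text \<open>The number counts machine steps; every test of a \<open>Cond\<close> or
  \<open>Loop\<close> is a step of its own.\<close>

inductive exec :: "prog \<Rightarrow> tape list \<Rightarrow> nat \<Rightarrow> tape list \<Rightarrow> bool" where
  exec_Act: "exec (Act i f) ts 1 (ts[i := act (f (map read ts)) (ts ! i)])"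
| exec_Seq: "exec p ts t ts' \<Longrightarrow> exec q ts' t' ts'' \<Longrightarrow> exec (Seq p q) ts (t + t') ts''"
| exec_Cond: "exec (if b (map read ts) then p else q) ts t ts' \<Longrightarrow> exec (Cond b p q) ts (Suc t) ts'"
| exec_Loop_stop: "\<not> b (map read ts) \<Longrightarrow> exec (Loop b p) ts 1 ts"
| exec_Loop_step: "b (map read ts) \<Longrightarrow> exec p ts t ts' \<Longrightarrow> exec (Loop b p) ts' t' ts'' \<Longrightarrow>
    exec (Loop b p) ts (Suc (t + t')) ts''"

section \<open>Compilation of programs into control states\<close>

fun states :: "prog \<Rightarrow> nat" where
  "states (Act i f) = 1"
| "states (Seq p q) = states p + states q"
| "states (Cond b p q) = Suc (states p + states q)"
| "states (Loop b p) = Suc (states p)"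

text \<open>A program starts in state 0 and exits by entering the state \<open>states p\<close>.\<close>

fun transition :: "prog \<Rightarrow> nat \<Rightarrow> nat list \<Rightarrow> (nat \<times> (nat \<times> move) list) option" where
  "transition (Act i f) s ss = (if s = 0 then Some (1, (idle ss)[i := f ss]) else None)"
| "transition (Seq p q) s ss =
     (if s < states p then transition p s ss
      else map_option (apfst ((+) (states p))) (transition q (s - states p) ss))"
| "transition (Cond b p q) s ss =
     (if s = 0 then Some (if b ss then 1 else Suc (states p), idle ss)
      else if s \<le> states p then
        map_option (apfst (\<lambda>r. if r = states p then Suc (states p + states q) else Suc r))
          (transition p (s - 1) ss)
      else map_option (apfst ((+) (Suc (states p)))) (transition q (s - Suc (states p)) ss))"
| "transition (Loop b p) s ss =
     (if s = 0 then Some (if b ss then 1 else Suc (states p), idle ss)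
      else map_option (apfst (\<lambda>r. if r = states p then 0 else Suc r)) (transition p (s - 1) ss))"

lemma states_pos: "0 < states p"
  by (induction p) auto

text \<open>A machine that consists of \<open>p\<close> alone thus halts in the exit state, while a
  surrounding program is free to continue from there.\<close>

lemma transition_exit: "states p \<le> s \<Longrightarrow> transition p s ss = None"
  by (induction p arbitrary: s) (auto simp: states_pos)

lemma transition_less: "transition p s ss = Some r \<Longrightarrow> s < states p"
  using transition_exit[of p s ss] by (cases "s < states p") auto

fun well_formed :: "nat \<Rightarrow> nat \<Rightarrow> prog \<Rightarrow> bool" where
  "well_formed k m (Act i f) \<longleftrightarrow> (\<forall>ss\<in>tuples k {..<m}. fst (f ss) < m)"
| "well_formed k m (Seq p q) \<longleftrightarrow> well_formed k m p \<and> well_formed k m q"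
| "well_formed k m (Cond b p q) \<longleftrightarrow> well_formed k m p \<and> well_formed k m q"
| "well_formed k m (Loop b p) \<longleftrightarrow> well_formed k m p"

lemma transition_well_formed:
  assumes "well_formed k m p" and "ss \<in> tuples k {..<m}" and "transition p s ss = Some (s', as)"
  shows "s' \<le> states p \<and> length as = k \<and> (\<forall>(a, d)\<in>set as. a < m)"
proof -
  have idle: "length (idle ss) = k" "\<forall>(a, d)\<in>set (idle ss). a < m"
    using assms(2) by (auto simp: idle_def tuples_def)
  show ?thesis using assms(1,3)
  proof (induction p arbitrary: s s')
    case (Act i f)
    then have "s' = 1" "as = (idle ss)[i := f ss]" by (auto split: if_splits)
    moreover have "fst (f ss) < m" using Act assms(2) by simp
    ultimately show ?case
      using idle set_update_subset_insert[of "idle ss" i "f ss"]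
      by (cases "f ss") (auto dest!: subsetD)
  next
    case (Seq p q)
    show ?case
    proof (cases "s < states p")
      case True
      then show ?thesis using Seq.IH(1)[of s s'] Seq.prems by auto
    next
      case False
      then obtain r where "transition q (s - states p) ss = Some (r, as)" "s' = states p + r"
        using Seq.prems by auto
      then show ?thesis using Seq.IH(2) Seq.prems by auto
    qed
  next
    case (Cond b p q)
    consider "s = 0" | "0 < s" "s \<le> states p" | "s > states p" by linarith
    then show ?case
    proof cases
      case 1
      then show ?thesis using Cond.prems idle states_pos[of p] by auto
    next
      case 2
      then obtain r where "transition p (s - 1) ss = Some (r, as)"
        "s' = (if r = states p then Suc (states p + states q) else Suc r)"
        using Cond.prems by auto
      then show ?thesis using Cond.IH(1)[of "s - 1" r] Cond.prems by auto
    next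
      case 3
      then obtain r where "transition q (s - Suc (states p)) ss = Some (r, as)" "s' = Suc (states p) + r"
        using Cond.prems by auto
      then show ?thesis using Cond.IH(2) Cond.prems by auto
    qed
  next
    case (Loop b p)
    show ?case
    proof (cases "s = 0")
      case True
      then show ?thesis using Loop.prems idle by auto
    next
      case False
      then obtain r where "transition p (s - 1) ss = Some (r, as)" "s' = (if r = states p then 0 else Suc r)"
        using Loop.prems by auto
      then show ?thesis using Loop.IH[of "s - 1" r] Loop.prems by auto
    qed
  qed
qed

definition prog_machine :: "nat \<Rightarrow> nat \<Rightarrow> prog \<Rightarrow> machine" where
  "prog_machine k m p =
     \<lparr>num_tapes = k, num_states = Suc (states p), num_symbols = m, delta = transition p\<rparr>"

lemma turing_machine_prog:
  assumes "well_formed k m p" and "1 \<le> k" and "3 \<le> m"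
  shows "turing_machine (prog_machine k m p)"
  using assms transition_well_formed[OF assms(1)]
  by (auto simp: turing_machine_def prog_machine_def less_Suc_eq_le)

definition prog_step :: "prog \<Rightarrow> config rel" where
  "prog_step p = {((s, ts), (s', map2 act as ts)) | s ts s' as. transition p s (map read ts) = Some (s', as)}"

lemma step_prog_machine: "step (prog_machine k m p) = prog_step p"
  by (simp add: step_def prog_step_def prog_machine_def)

text \<open>Every constructor embeds its parts by renaming control states: a shift, with the exit of
  the part sent to where control continues. Runs of a part thereby become runs of the whole, of the
  same length.\<close>

lemma prog_step_relpow_embed:
  assumes "((s, ts), (s', ts')) \<in> prog_step p ^^ t"
    and "\<And>s ss s' as. transition p s ss = Some (s', as) \<Longrightarrow> transition q (f s) ss = Some (f s', as)"
  shows "((f s, ts), (f s', ts')) \<in> prog_step q ^^ t"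
  using relpow_simulation[where f = "apfst f" and I = "\<lambda>_. True" and R = "prog_step p"
      and S = "prog_step q", OF _ assms(1)] assms(2)
  by (fastforce simp: prog_step_def)

lemma map2_act_update:
  "length as = length ts \<Longrightarrow> map2 act (as[i := a]) ts = (map2 act as ts)[i := act a (ts ! i)]"
  by (cases "i < length ts") (auto intro!: nth_equalityI simp: nth_list_update)

lemma prog_step_idle:
  "transition p s (map read ts) = Some (s', idle (map read ts)) \<Longrightarrow> ((s, ts), (s', ts)) \<in> prog_step p"
  unfolding prog_step_def using map2_act_idle[of ts] by force

lemma relpow_Suc_add:
  "(a, b) \<in> R \<Longrightarrow> (b, c) \<in> R ^^ m \<Longrightarrow> (c, d) \<in> R ^^ n \<Longrightarrow> (a, d) \<in> R ^^ Suc (m + n)"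
  by (meson relcompI relpow_Suc_I2 relpow_add relpow_trans)

lemma exec_run: "exec p ts t ts' \<Longrightarrow> ((0, ts), (states p, ts')) \<in> prog_step p ^^ t"
proof (induction rule: exec.induct)
  case (exec_Act i f ts)
  have "ts[i := act (f (map read ts)) (ts ! i)] = map2 act ((idle (map read ts))[i := f (map read ts)]) ts"
    by (simp add: map2_act_update)
  then show ?case by (auto simp: prog_step_def)
next
  case (exec_Seq p ts t ts' q t' ts'')
  have "((0, ts), (states p, ts')) \<in> prog_step (Seq p q) ^^ t"
    by (rule prog_step_relpow_embed[OF exec_Seq.IH(1), where f = "\<lambda>s. s", simplified])
      (auto dest: transition_less)
  moreover have "((states p, ts'), (states p + states q, ts'')) \<in> prog_step (Seq p q) ^^ t'"
    using prog_step_relpow_embed[OF exec_Seq.IH(2), where f = "(+) (states p)" and q = "Seq p q"]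
    by auto
  ultimately show ?case by (auto intro: relpow_trans)
next
  case (exec_Cond b ts p q t ts')
  let ?c = "Cond b p q"
  show ?case
  proof (cases "b (map read ts)")
    case True
    let ?f = "\<lambda>r. if r = states p then Suc (states p + states q) else Suc r"
    have "((?f 0, ts), (?f (states p), ts')) \<in> prog_step ?c ^^ t"
    proof (rule prog_step_relpow_embed[where f = ?f])
      show "((0, ts), (states p, ts')) \<in> prog_step p ^^ t" using exec_Cond.IH True by simp
      show "transition ?c (?f s) ss = Some (?f s', as)" if "transition p s ss = Some (s', as)" for s ss s' as
        using that transition_less[OF that] by simp
    qed
    moreover have "((0, ts), (?f 0, ts)) \<in> prog_step ?c"
      using True states_pos[of p] by (intro prog_step_idle) simp
    ultimately show ?thesis using relpow_Suc_I2[of "(0, ts)"] by simp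
  next
    case False
    have "((Suc (states p) + 0, ts), (Suc (states p) + states q, ts')) \<in> prog_step ?c ^^ t"
      using exec_Cond.IH False
      by (intro prog_step_relpow_embed[where p = q and f = "(+) (Suc (states p))"]) auto
    moreover have "((0, ts), (Suc (states p) + 0, ts)) \<in> prog_step ?c"
      using False by (intro prog_step_idle) simp
    ultimately show ?thesis using relpow_Suc_I2[of "(0, ts)"] by simp
  qed
next
  case (exec_Loop_stop b ts p)
  then have "((0, ts), (Suc (states p), ts)) \<in> prog_step (Loop b p)"
    by (intro prog_step_idle) simp
  then show ?case by simp
next
  case (exec_Loop_step b ts p t ts' t' ts'')
  let ?f = "\<lambda>r. if r = states p then 0 else Suc r"
  have "((?f 0, ts), (?f (states p), ts')) \<in> prog_step (Loop b p) ^^ t"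
  proof (rule prog_step_relpow_embed[OF exec_Loop_step.IH(1), where f = ?f])
    show "transition (Loop b p) (?f s) ss = Some (?f s', as)" if "transition p s ss = Some (s', as)" for s ss s' as
      using that transition_less[OF that] by simp
  qed
  moreover have "((0, ts), (?f 0, ts)) \<in> prog_step (Loop b p)"
    using exec_Loop_step.hyps(1) states_pos[of p] by (intro prog_step_idle) simp
  ultimately show ?case
    using exec_Loop_step.IH(2) by (simp del: relpow.simps add: relpow_Suc_add)
qed

text \<open>Upper bounds in place of exact step counts let branches of different cost share one
  estimate.\<close>

definition runs :: "prog \<Rightarrow> tape list \<Rightarrow> nat \<Rightarrow> tape list \<Rightarrow> bool" where
  "runs p ts T ts' \<longleftrightarrow> (\<exists>t\<le>T. exec p ts t ts')"

lemma runs_mono: "runs p ts T ts' \<Longrightarrow> T \<le> T' \<Longrightarrow> runs p ts T' ts'"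
  unfolding runs_def by (meson order_trans)

lemma runs_Act: "ts' = ts[i := act (f (map read ts)) (ts ! i)] \<Longrightarrow> runs (Act i f) ts 1 ts'"
  unfolding runs_def using exec_Act by blast

lemma runs_Seq: "runs p ts T ts' \<Longrightarrow> runs q ts' T' ts'' \<Longrightarrow> runs (Seq p q) ts (T + T') ts''"
  unfolding runs_def using exec_Seq by (meson add_mono)

lemma runs_Cond: "runs (if b (map read ts) then p else q) ts T ts' \<Longrightarrow> runs (Cond b p q) ts (Suc T) ts'"
  unfolding runs_def using exec_Cond by (meson Suc_le_mono)

text \<open>\<open>s\<close> lists the tapes between the iterations. Each iteration costs its test
  besides \<open>T\<close>, and the failing test is the final 1.\<close>

lemma runs_Loop:
  assumes "\<And>i. i < n \<Longrightarrow> b (map read (s i))" and "\<And>i. i < n \<Longrightarrow> runs p (s i) T (s (Suc i))"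
    and "\<not> b (map read (s n))"
  shows "runs (Loop b p) (s 0) (n * Suc T + 1) (s n)"
  using assms
proof (induction n arbitrary: s)
  case 0
  then show ?case unfolding runs_def using exec_Loop_stop[of b "s 0" p] by auto
next
  case (Suc n)
  have "runs (Loop b p) (s (Suc 0)) (n * Suc T + 1) (s (Suc n))"
    using Suc.prems by (intro Suc.IH[of "\<lambda>i. s (Suc i)"]) auto
  then obtain t t' where "t \<le> T" "exec p (s 0) t (s (Suc 0))"
    "t' \<le> n * Suc T + 1" "exec (Loop b p) (s (Suc 0)) t' (s (Suc n))"
    using Suc.prems(2)[of 0] unfolding runs_def by auto
  then show ?case
    unfolding runs_def using exec_Loop_step[of b "s 0"] Suc.prems(1)[of 0]
    by (intro exI[of _ "Suc (t + t')"]) auto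
qed

lemma poly_time_prog:
  fixes P :: "nat poly"
  assumes "well_formed k m p" and "1 \<le> k" and "3 \<le> m"
    and "\<And>w. \<exists>ts. runs p (word_tape w # replicate (k - 1) (word_tape [])) (poly P (length w)) ts \<and>
           ts ! 0 = word_tape (f w)"
  shows "poly_time f"
proof -
  have "computes_within (prog_machine k m p) w (poly P (length w)) (f w)" for w
  proof -
    obtain ts t where "t \<le> poly P (length w)" "ts ! 0 = word_tape (f w)"
      "exec p (word_tape w # replicate (k - 1) (word_tape [])) t ts"
      using assms(4)[of w] unfolding runs_def by auto
    then show ?thesis
      using exec_run unfolding computes_within_def step_prog_machine
      by (fastforce simp: init_config_def prog_machine_def halted_def transition_exit)
  qed
  then show ?thesis
    using turing_machine_prog[OF assms(1-3)] unfolding poly_time_def by blast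
qed


section \<open>Tapes as registers\<close>

definition tape_at :: "bool list \<Rightarrow> int \<Rightarrow> tape" where
  "tape_at w i = (fst (word_tape w), i)"

text \<open>A tape used as a register has its head on the first blank after the word.\<close>

abbreviation reg :: "bool list \<Rightarrow> tape" where
  "reg w \<equiv> tape_at w (int (length w))"

lemma word_tape_eq: "word_tape w = tape_at w 0"
  by (simp add: tape_at_def word_tape_def)

lemma read_tape_at:
  "read (tape_at w i) = (if 0 \<le> i \<and> i < int (length w) then if w ! nat i then 2 else 1 else 0)"
  by (simp add: tape_at_def word_tape_def)

lemma act_read_tape_at: "act (read (tape_at w i), d) (tape_at w i) = tape_at w (i + offset d)"
  by (simp add: tape_at_def)

lemma act_snoc: "act (if b then 2 else 1, Right) (reg w) = reg (w @ [b])"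
  by (auto simp: tape_at_def word_tape_def nth_append fun_eq_iff nat_less_iff)

lemma act_butlast: "act (0, Left) (tape_at (w @ [b]) (int (length w))) = tape_at w (int (length w) - 1)"
  by (auto simp: tape_at_def word_tape_def nth_append fun_eq_iff nat_less_iff)

section \<open>Elementary operations on registers\<close>

definition put :: "nat \<Rightarrow> bool \<Rightarrow> prog" where
  "put i b = Act i (\<lambda>_. (if b then 2 else 1, Right))"

lemma runs_put:
  assumes "ts ! i = reg w"
  shows "runs (put i b) ts 1 (ts[i := reg (w @ [b])])"
  unfolding put_def using assms by (intro runs_Act) (simp only: act_snoc)

text \<open>The head of a register is behind the word, where the loop would stop at once; hence the
  initial move to the left. The loop ends on the blank at position -1; hence the final move to the
  right.\<close>

definition rewind :: "nat \<Rightarrow> prog" where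
  "rewind j = Seq (Act j (\<lambda>ss. (ss ! j, Left)))
     (Seq (Loop (\<lambda>ss. ss ! j \<noteq> 0) (Act j (\<lambda>ss. (ss ! j, Left))))
       (Act j (\<lambda>ss. (ss ! j, Right))))"

lemma runs_rewind:
  assumes j: "j < length ts" and w: "ts ! j = reg w"
  shows "runs (rewind j) ts (2 * length w + 3) (ts[j := tape_at w 0])"
proof -
  define s where "s i = ts[j := tape_at w (int (length w) - 1 - int i)]" for i
  have "runs (Act j (\<lambda>ss. (ss ! j, Left))) ts 1 (s 0)"
    using j w by (intro runs_Act) (simp add: s_def act_read_tape_at)
  moreover have "runs (Loop (\<lambda>ss. ss ! j \<noteq> 0) (Act j (\<lambda>ss. (ss ! j, Left))))
      (s 0) (length w * Suc 1 + 1) (s (length w))"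
  proof (rule runs_Loop)
    show "runs (Act j (\<lambda>ss. (ss ! j, Left))) (s i) 1 (s (Suc i))" for i
      using j by (intro runs_Act) (simp add: s_def act_read_tape_at algebra_simps)
  qed (use j in \<open>auto simp: s_def read_tape_at\<close>)
  moreover have "runs (Act j (\<lambda>ss. (ss ! j, Right))) (s (length w)) 1 (ts[j := tape_at w 0])"
    using j by (intro runs_Act) (simp add: s_def act_read_tape_at)
  ultimately have "runs (rewind j) ts (1 + (length w * Suc 1 + 1 + 1)) (ts[j := tape_at w 0])"
    unfolding rewind_def by (intro runs_Seq)
  then show ?thesis by (rule runs_mono) simp
qed

definition clear :: "nat \<Rightarrow> prog" where
  "clear j = Seq (Act j (\<lambda>ss. (ss ! j, Left)))
     (Seq (Loop (\<lambda>ss. ss ! j \<noteq> 0) (Act j (\<lambda>_. (0, Left))))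
       (Act j (\<lambda>ss. (ss ! j, Right))))"

lemma runs_clear:
  assumes j: "j < length ts" and w: "ts ! j = reg w"
  shows "runs (clear j) ts (2 * length w + 3) (ts[j := reg []])"
proof -
  \<comment> \<open>After \<open>i\<close> rounds \<open>i\<close> symbols are erased and the head
    is on the last one left, or at -1 when none is left.\<close>
  define s where "s i = ts[j := tape_at (take (length w - i) w) (int (length w) - 1 - int i)]" for i
  have "runs (Act j (\<lambda>ss. (ss ! j, Left))) ts 1 (s 0)"
    using j w by (intro runs_Act) (simp add: s_def act_read_tape_at)
  moreover have "runs (Loop (\<lambda>ss. ss ! j \<noteq> 0) (Act j (\<lambda>_. (0, Left))))
      (s 0) (length w * Suc 1 + 1) (s (length w))"
  proof (rule runs_Loop)
    fix i assume i: "i < length w"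
    define v where "v = take (length w - Suc i) w"
    have "take (length w - i) w = v @ [w ! length v]" "int (length w) - 1 - int i = int (length v)"
      using i by (simp_all add: v_def Suc_diff_Suc flip: take_Suc_conv_app_nth)
    then show "runs (Act j (\<lambda>_. (0, Left))) (s i) 1 (s (Suc i))"
      using j act_butlast[of v]
      by (intro runs_Act) (simp add: s_def algebra_simps flip: v_def)
  qed (use j in \<open>auto simp: s_def read_tape_at\<close>)
  moreover have "runs (Act j (\<lambda>ss. (ss ! j, Right))) (s (length w)) 1 (ts[j := reg []])"
    using j by (intro runs_Act) (simp add: s_def act_read_tape_at)
  ultimately have "runs (clear j) ts (1 + (length w * Suc 1 + 1 + 1)) (ts[j := reg []])"
    unfolding clear_def by (intro runs_Seq)
  then show ?thesis by (rule runs_mono) simp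
qed

text \<open>Tape \<open>j\<close> is read from the left up to the blank behind its word, so it ends
  as a register again and can be copied any number of times.\<close>

definition append_to :: "nat \<Rightarrow> nat \<Rightarrow> prog" where
  "append_to i j = Seq (rewind j)
     (Loop (\<lambda>ss. ss ! j \<noteq> 0) (Seq (Act i (\<lambda>ss. (ss ! j, Right))) (Act j (\<lambda>ss. (ss ! j, Right)))))"

lemma runs_append_to:
  assumes ij: "i < length ts" "j < length ts" "i \<noteq> j"
    and v: "ts ! i = reg v" and w: "ts ! j = reg w"
  shows "runs (append_to i j) ts (5 * length w + 4) (ts[i := reg (v @ w)])"
proof -
  define s where "s k = ts[j := tape_at w (int k), i := reg (v @ take k w)]" for k
  have "s 0 = ts[j := tape_at w 0]"
    using ij v by (simp add: s_def list_update_same_conv)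
  then have "runs (rewind j) ts (2 * length w + 3) (s 0)"
    using runs_rewind[OF ij(2) w] by simp
  moreover have "runs (Loop (\<lambda>ss. ss ! j \<noteq> 0)
        (Seq (Act i (\<lambda>ss. (ss ! j, Right))) (Act j (\<lambda>ss. (ss ! j, Right)))))
      (s 0) (length w * Suc (1 + 1) + 1) (s (length w))"
  proof (rule runs_Loop)
    fix k assume k: "k < length w"
    let ?t = "ts[j := tape_at w (int k), i := reg (v @ take (Suc k) w)]"
    have "read (tape_at w (int k)) = (if w ! k then 2 else 1)"
      using k by (simp add: read_tape_at)
    then have "runs (Act i (\<lambda>ss. (ss ! j, Right))) (s k) 1 ?t"
      using ij k act_snoc[of "w ! k" "v @ take k w"]
      by (intro runs_Act) (simp add: s_def take_Suc_conv_app_nth)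
    moreover have "runs (Act j (\<lambda>ss. (ss ! j, Right))) ?t 1 (s (Suc k))"
      using ij by (intro runs_Act)
        (simp add: s_def act_read_tape_at list_update_swap[of i j] algebra_simps)
    ultimately show "runs (Seq (Act i (\<lambda>ss. (ss ! j, Right))) (Act j (\<lambda>ss. (ss ! j, Right))))
        (s k) (1 + 1) (s (Suc k))"
      by (rule runs_Seq)
  qed (use ij in \<open>auto simp: s_def read_tape_at\<close>)
  moreover have "s (length w) = ts[i := reg (v @ w)]"
    using ij w by (simp add: s_def flip: w)
  ultimately have "runs (append_to i j) ts (2 * length w + 3 + (length w * Suc (1 + 1) + 1)) (ts[i := reg (v @ w)])"
    unfolding append_to_def by (simp only:) (rule runs_Seq)
  then show ?thesis by (rule runs_mono) simp
qed

definition skip :: prog where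
  "skip = Act 0 (\<lambda>ss. (ss ! 0, Stay))"

lemma runs_skip: "ts \<noteq> [] \<Longrightarrow> runs skip ts 1 ts"
  unfolding skip_def by (intro runs_Act) simp

text \<open>A token list is a fixed text with holes for the contents of registers; the output for
  one edge has this form.\<close>

datatype token = Bit bool | Reg nat

definition expand :: "(nat \<Rightarrow> bool list) \<Rightarrow> token list \<Rightarrow> bool list" where
  "expand r tk = concat (map (\<lambda>x. case x of Bit b \<Rightarrow> [b] | Reg j \<Rightarrow> r j) tk)"

lemma expand_simps [simp]:
  "expand r [] = []"
  "expand r (Bit b # tk) = b # expand r tk"
  "expand r (Reg j # tk) = r j @ expand r tk"
  "expand r (tk @ tk') = expand r tk @ expand r tk'"
  by (simp_all add: expand_def)

lemma expand_replicate_Bit [simp]: "expand r (replicate n (Bit b)) = replicate n b"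
  by (induction n) simp_all

lemma length_expand_le:
  assumes "\<And>j. Reg j \<in> set tk \<Longrightarrow> length (r j) \<le> n"
  shows "length (expand r tk) \<le> length tk * Suc n"
  using assms
proof (induction tk)
  case (Cons x tk)
  have "length (expand r tk) \<le> length tk * Suc n" using Cons by simp
  moreover have "length (expand r (x # tk)) \<le> Suc n + length (expand r tk)"
    using Cons.prems by (cases x) fastforce+
  ultimately show ?case by simp
qed simp

fun emit :: "nat \<Rightarrow> token list \<Rightarrow> prog" where
  "emit i [] = skip"
| "emit i (Bit b # tk) = Seq (put i b) (emit i tk)"
| "emit i (Reg j # tk) = Seq (append_to i j) (emit i tk)"

lemma runs_emit:
  assumes "i < length ts" and "ts ! i = reg v"
    and "\<And>j. Reg j \<in> set tk \<Longrightarrow> j \<noteq> i \<and> j < length ts \<and> ts ! j = reg (r j) \<and> length (r j) \<le> n"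
  shows "runs (emit i tk) ts (length tk * (5 * n + 4) + 1) (ts[i := reg (v @ expand r tk)])"
  using assms
proof (induction tk arbitrary: ts v)
  case Nil
  then show ?case using runs_skip[of ts] by (cases ts) (auto simp flip: Nil.prems(2))
next
  case (Cons x tk)
  define x' where "x' = expand r [x]"
  let ?ts = "ts[i := reg (v @ x')]"
  have rest: "runs (emit i tk) ?ts (length tk * (5 * n + 4) + 1) (?ts[i := reg ((v @ x') @ expand r tk)])"
  proof (rule Cons.IH)
    show "j \<noteq> i \<and> j < length ?ts \<and> ?ts ! j = reg (r j) \<and> length (r j) \<le> n"
      if "Reg j \<in> set tk" for j
      using Cons.prems(3)[of j] that by auto
  qed (use Cons.prems in auto)
  show ?case
  proof (cases x)
    case (Bit b)
    have "runs (put i b) ts (5 * n + 4) ?ts"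
      using runs_put[OF Cons.prems(2), of b] Bit by (auto simp: x'_def intro: runs_mono)
    from runs_Seq[OF this rest] show ?thesis using Bit by (simp add: x'_def algebra_simps)
  next
    case (Reg j)
    have j: "j \<noteq> i \<and> j < length ts \<and> ts ! j = reg (r j) \<and> length (r j) \<le> n"
      using Cons.prems(3) Reg by simp
    then have "runs (append_to i j) ts (5 * length (r j) + 4) ?ts"
      using runs_append_to[of i ts j v "r j"] Cons.prems(1,2) Reg by (auto simp: x'_def)
    then have "runs (append_to i j) ts (5 * n + 4) ?ts" by (rule runs_mono) (use j in simp)
    from runs_Seq[OF this rest] show ?thesis using Reg by (simp add: x'_def algebra_simps)
  qed
qed

lemma well_formed_emit:
  assumes "3 \<le> m" and "0 < k" and "\<And>j. Reg j \<in> set tk \<Longrightarrow> j < k"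
  shows "well_formed k m (emit i tk)"
  using assms(3)
proof (induction tk)
  case Nil
  then show ?case using assms(1,2) by (auto simp: skip_def tuples_def subset_eq)
next
  case (Cons x tk)
  then show ?case using assms(1,2)
    by (cases x) (auto simp: put_def append_to_def rewind_def tuples_def subset_eq)
qed


section \<open>Expanding a template for every edge\<close>

text \<open>
  The components are the control state, the output, unary registers for the two ends of the current
  edge and for the number of edges read so far, and the header of the output.
\<close>

type_synonym scan_state = "nat \<times> bool list \<times> bool list \<times> bool list \<times> bool list \<times> bool list"

text \<open>The indices are the positions of the three registers among the tapes of
  \<open>conf\<close>.\<close>

definition scan_regs :: "bool list \<Rightarrow> bool list \<Rightarrow> bool list \<Rightarrow> nat \<Rightarrow> bool list" where
  "scan_regs us vs es = (\<lambda>j. if j = 2 then us else if j = 3 then vs else es)"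

text \<open>State 0 reads the number of vertices, state 1 the index of the relation symbol, states 2
  and 3 the two ends. The only index is 0, whose word is the single bit \<open>False\<close>, so
  state 1 lasts one bit. The header grows by \<open>B\<close> with every input bit; it is kept apart
  from the facts since it precedes them in the output but is complete only after the scan.\<close>

fun scan_step :: "nat \<Rightarrow> token list \<Rightarrow> scan_state \<Rightarrow> bool \<Rightarrow> scan_state" where
  "scan_step B tk (q, out, us, vs, es, hs) b =
     (let hs' = hs @ replicate B True in
      if q = 0 then (if b then 0 else 1, out, us, vs, es, hs')
      else if q = 1 then (2, out, [], [], es, hs')
      else if q = 2 then (if b then (2, out, us @ [True], vs, es, hs') else (3, out, us, vs, es, hs'))
      else if b then (3, out, us, vs @ [True], es, hs')
      else (1, out @ expand (scan_regs us vs es) tk, us, vs, es @ [True], hs'))"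

definition scan :: "nat \<Rightarrow> token list \<Rightarrow> bool list \<Rightarrow> scan_state" where
  "scan B tk w = foldl (scan_step B tk) (0, [], [], [], [], []) w"

definition scan_word :: "nat \<Rightarrow> token list \<Rightarrow> bool list \<Rightarrow> bool list" where
  "scan_word B tk w = (case scan B tk w of (q, out, us, vs, es, hs) \<Rightarrow> hs @ [False] @ out)"

text \<open>Programs branch on symbols only, so the control state of the scan is itself a symbol, on
  the last tape. Its four values are the reason for four tape symbols.\<close>

fun conf :: "bool list \<Rightarrow> nat \<Rightarrow> scan_state \<Rightarrow> tape list" where
  "conf w i (q, out, us, vs, es, hs) =
     [tape_at w (int i), reg out, reg us, reg vs, reg es, reg hs, ((\<lambda>_. 0)(0 := q), 0)]"

declare conf.simps [simp del]

lemma read_conf_input [simp]: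
  "map read (conf w i s) ! 0 = (if i < length w then if w ! i then 2 else 1 else 0)"
  by (cases s) (simp add: conf.simps read_tape_at)

lemma read_conf_state [simp]: "map read (conf w i (q, r)) ! 6 = q"
  by (cases r) (simp add: conf.simps)

lemma conf_nonempty: "conf w i s \<noteq> []"
  by (cases s) (simp add: conf.simps)

text \<open>Each input bit lengthens a unary register by at most one bit and causes at most one
  expansion, of at most \<open>l * Suc n\<close> bits.\<close>

fun scan_bounded :: "nat \<Rightarrow> nat \<Rightarrow> nat \<Rightarrow> scan_state \<Rightarrow> bool" where
  "scan_bounded B l n (q, out, us, vs, es, hs) \<longleftrightarrow> q < 4 \<and> length us \<le> n \<and> length vs \<le> n \<and>
     length es \<le> n \<and> length out \<le> n * (l * Suc n) \<and> hs = replicate (B * n) True"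

lemma scan_bounded_scan: "scan_bounded B (length tk) (length w) (scan B tk w)"
proof (induction w rule: rev_induct)
  case Nil
  then show ?case by (simp add: scan_def)
next
  case (snoc b w)
  let ?n = "length w" and ?l = "length tk"
  obtain q out us vs es hs where s: "scan B tk w = (q, out, us, vs, es, hs)" by (metis prod_cases6)
  have IH: "scan_bounded B ?l ?n (q, out, us, vs, es, hs)" using snoc s by simp
  have "length (expand (scan_regs us vs es) tk) \<le> ?l * Suc ?n"
    using IH by (intro length_expand_le) (auto simp: scan_regs_def)
  moreover have "?n * (?l * Suc ?n) + ?l * Suc ?n \<le> Suc ?n * (?l * Suc (Suc ?n))"
    by (simp add: algebra_simps)
  ultimately have "length out + length (expand (scan_regs us vs es) tk) \<le> Suc ?n * (?l * Suc (Suc ?n))"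
    "length out \<le> Suc ?n * (?l * Suc (Suc ?n))"
    using IH by auto
  moreover have "scan B tk (w @ [b]) = scan_step B tk (q, out, us, vs, es, hs) b"
    using s by (simp add: scan_def)
  ultimately show ?case
    using IH by (auto simp: Let_def add.commute[of B] replicate_add)
qed

section \<open>The program for the scan and its running time\<close>

definition goto :: "nat \<Rightarrow> prog" where
  "goto q = Act 6 (\<lambda>_. (q, Stay))"

definition scan_body :: "nat \<Rightarrow> token list \<Rightarrow> prog" where
  "scan_body B tk =
     Seq (emit 5 (replicate B (Bit True)))
    (Seq (Cond (\<lambda>ss. ss ! 6 = 0) (Cond (\<lambda>ss. ss ! 0 = 2) skip (goto 1))
         (Cond (\<lambda>ss. ss ! 6 = 1) (Seq (clear 2) (Seq (clear 3) (goto 2)))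
         (Cond (\<lambda>ss. ss ! 6 = 2) (Cond (\<lambda>ss. ss ! 0 = 2) (put 2 True) (goto 3))
         (Cond (\<lambda>ss. ss ! 0 = 2) (put 3 True) (Seq (emit 1 tk) (Seq (put 4 True) (goto 1)))))))
      (Act 0 (\<lambda>ss. (ss ! 0, Right))))"

text \<open>At most \<open>B + l\<close> tokens are emitted, each within \<open>5 * n + 4\<close>
  steps; \<open>4 * n\<close> is for clearing two registers and 20 for all fixed costs.\<close>

definition scan_cost :: "nat \<Rightarrow> nat \<Rightarrow> nat \<Rightarrow> nat" where
  "scan_cost B l n = (B + l) * (5 * n + 4) + 4 * n + 20"

lemma runs_scan_body:
  assumes tk: "\<And>j. Reg j \<in> set tk \<Longrightarrow> j \<in> {2, 3, 4}"
    and i: "i < length w" and s: "scan_bounded B l i s"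
  shows "runs (scan_body B tk) (conf w i s) (scan_cost B (length tk) (length w))
    (conf w (Suc i) (scan_step B tk s (w ! i)))"
proof -
  obtain q out us vs es hs where s_eq: "s = (q, out, us, vs, es, hs)" by (metis prod_cases6)
  define n where "n = length w"
  have q: "q < 4" and len: "length us \<le> n" "length vs \<le> n" "length es \<le> n"
    using s s_eq i by (auto simp: n_def)
  let ?hs = "hs @ replicate B True"
  let ?s = "(q, out, us, vs, es, ?hs)"
  have goto: "runs (goto q') (conf w i (q0, out0, us0, vs0, es0, hs0)) 1 (conf w i (q', out0, us0, vs0, es0, hs0))"
    for q' q0 out0 us0 vs0 es0 hs0
    unfolding goto_def by (intro runs_Act) (simp add: conf.simps)
  have 1: "runs (emit 5 (replicate B (Bit True))) (conf w i s) (B * (5 * n + 4) + 1) (conf w i ?s)"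
    using runs_emit[of 5 "conf w i s" hs "replicate B (Bit True)" "\<lambda>_. []" n]
    by (simp add: s_eq conf.simps)
  have "\<exists>T\<le>length tk * (5 * n + 4) + 4 * n + 15.
    runs (Cond (\<lambda>ss. ss ! 6 = 0) (Cond (\<lambda>ss. ss ! 0 = 2) skip (goto 1))
         (Cond (\<lambda>ss. ss ! 6 = 1) (Seq (clear 2) (Seq (clear 3) (goto 2)))
         (Cond (\<lambda>ss. ss ! 6 = 2) (Cond (\<lambda>ss. ss ! 0 = 2) (put 2 True) (goto 3))
         (Cond (\<lambda>ss. ss ! 0 = 2) (put 3 True) (Seq (emit 1 tk) (Seq (put 4 True) (goto 1)))))))
     (conf w i ?s) T (conf w i (scan_step B tk s (w ! i)))"
    (is "\<exists>T\<le>_. ?runs T")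
  proof -
    consider "q = 0" | "q = 1" | "q = 2" | "q = 3" using q by linarith
    then show ?thesis
    proof cases
      case 1
      have "?runs (Suc (Suc 1))"
        using 1 i goto[of 1] runs_skip[of "conf w i ?s"] conf_nonempty
        by (intro runs_Cond) (auto simp: s_eq Let_def intro!: runs_Cond)
      then show ?thesis by (intro exI[of _ "Suc (Suc 1)"]) simp
    next
      case 2
      have "runs (clear 2) (conf w i ?s) (2 * length us + 3) (conf w i (q, out, [], vs, es, ?hs))"
        using runs_clear[of 2 "conf w i ?s" us] by (simp add: conf.simps)
      moreover have "runs (clear 3) (conf w i (q, out, [], vs, es, ?hs)) (2 * length vs + 3)
          (conf w i (q, out, [], [], es, ?hs))"
        using runs_clear[of 3 "conf w i (q, out, [], vs, es, ?hs)" vs] by (simp add: conf.simps)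
      ultimately have "runs (Seq (clear 2) (Seq (clear 3) (goto 2))) (conf w i ?s)
          (2 * length us + 3 + (2 * length vs + 3 + 1)) (conf w i (2, out, [], [], es, ?hs))"
        using goto by (intro runs_Seq)
      moreover define m where "m = 4 * n + 7"
      ultimately have "runs (Seq (clear 2) (Seq (clear 3) (goto 2))) (conf w i ?s) m
          (conf w i (2, out, [], [], es, ?hs))"
        by (elim runs_mono) (use len in simp)
      then have "?runs (Suc (Suc m))"
        using 2 by (intro runs_Cond) (auto simp: s_eq Let_def intro!: runs_Cond)
      then show ?thesis by (intro exI[of _ "Suc (Suc m)"]) (simp add: m_def)
    next
      case 3
      have "runs (put 2 True) (conf w i ?s) 1 (conf w i (2, out, us @ [True], vs, es, ?hs))"
        using 3 runs_put[of "conf w i ?s" 2 us True] by (simp add: conf.simps)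
      then have "?runs (Suc (Suc (Suc (Suc 1))))"
        using 3 i goto[of 3] by (intro runs_Cond) (auto simp: s_eq Let_def intro!: runs_Cond)
      then show ?thesis by (intro exI[of _ "Suc (Suc (Suc (Suc 1)))"]) simp
    next
      case 4
      let ?x = "expand (scan_regs us vs es) tk"
      have put3: "runs (put 3 True) (conf w i ?s) 1 (conf w i (3, out, us, vs @ [True], es, ?hs))"
        using 4 runs_put[of "conf w i ?s" 3 vs True] by (simp add: conf.simps)
      have "j \<noteq> 1 \<and> j < length (conf w i ?s) \<and> conf w i ?s ! j = reg (scan_regs us vs es j) \<and>
          length (scan_regs us vs es j) \<le> n" if "Reg j \<in> set tk" for j
        using tk[OF that] len by (auto simp: conf.simps scan_regs_def)
      then have "runs (emit 1 tk) (conf w i ?s) (length tk * (5 * n + 4) + 1)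
          (conf w i (q, out @ ?x, us, vs, es, ?hs))"
        using runs_emit[of 1 "conf w i ?s" out tk "scan_regs us vs es" n]
        by (simp add: conf.simps)
      moreover have "runs (put 4 True) (conf w i (q, out @ ?x, us, vs, es, ?hs)) 1
          (conf w i (q, out @ ?x, us, vs, es @ [True], ?hs))"
        using runs_put[of "conf w i (q, out @ ?x, us, vs, es, ?hs)" 4 es True] by (simp add: conf.simps)
      ultimately have "runs (Seq (emit 1 tk) (Seq (put 4 True) (goto 1))) (conf w i ?s)
          (length tk * (5 * n + 4) + 1 + (1 + 1)) (conf w i (1, out @ ?x, us, vs, es @ [True], ?hs))"
        using goto by (intro runs_Seq)
      moreover have "runs (put 3 True) (conf w i ?s) (length tk * (5 * n + 4) + 1 + (1 + 1))
          (conf w i (3, out, us, vs @ [True], es, ?hs))"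
        by (rule runs_mono[OF put3]) simp
      ultimately have "?runs (Suc (Suc (Suc (Suc (length tk * (5 * n + 4) + 1 + (1 + 1))))))"
        using 4 i by (intro runs_Cond) (auto simp: s_eq Let_def intro!: runs_Cond)
      then show ?thesis
        by (intro exI[of _ "Suc (Suc (Suc (Suc (length tk * (5 * n + 4) + 1 + (1 + 1)))))"]) simp
    qed
  qed
  then obtain T where T: "T \<le> length tk * (5 * n + 4) + 4 * n + 15" "?runs T" by blast
  have "runs (Act 0 (\<lambda>ss. (ss ! 0, Right))) (conf w i s') 1 (conf w (Suc i) s')" for s'
    by (cases s', intro runs_Act) (simp add: conf.simps act_read_tape_at add.commute)
  from runs_Seq[OF 1 runs_Seq[OF T(2) this]]
  have "runs (scan_body B tk) (conf w i s) (B * (5 * n + 4) + 1 + (T + 1))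
      (conf w (Suc i) (scan_step B tk s (w ! i)))"
    unfolding scan_body_def .
  then show ?thesis
    by (rule runs_mono) (use T in \<open>simp add: scan_cost_def n_def algebra_simps\<close>)
qed

definition scan_prog :: "nat \<Rightarrow> token list \<Rightarrow> prog" where
  "scan_prog B tk = Seq (Loop (\<lambda>ss. ss ! 0 \<noteq> 0) (scan_body B tk))
     (Seq (clear 0) (Seq (put 5 False) (Seq (append_to 0 5) (Seq (append_to 0 1) (rewind 0)))))"

text \<open>The scan leaves the head of the input tape on the blank behind the input, so this tape
  is a register as well: it is cleared and then receives the header, the separator and the
  facts.\<close>

lemma runs_scan_prog:
  assumes tk: "\<And>j. Reg j \<in> set tk \<Longrightarrow> j \<in> {2, 3, 4}"
  shows "\<exists>ts. runs (scan_prog B tk) (word_tape w # replicate 6 (word_tape []))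
      (length w * Suc (scan_cost B (length tk) (length w)) + 1 + (2 * length w + 3 + (1 +
        (5 * (B * length w + 1) + 4 + (5 * (length w * (length tk * Suc (length w))) + 4 +
          (2 * (B * length w + 1 + length w * (length tk * Suc (length w))) + 3))))))
      ts \<and> ts ! 0 = word_tape (scan_word B tk w)"
proof -
  let ?n = "length w" and ?l = "length tk"
  define s where "s i = scan B tk (take i w)" for i
  have bounded: "scan_bounded B ?l i (s i)" if "i \<le> ?n" for i
    using scan_bounded_scan[of B tk "take i w"] that by (simp add: s_def)
  have "runs (Loop (\<lambda>ss. ss ! 0 \<noteq> 0) (scan_body B tk)) (conf w 0 (s 0))
     (?n * Suc (scan_cost B ?l ?n) + 1) (conf w ?n (s ?n))"
  proof (rule runs_Loop)
    fix i assume "i < ?n"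
    then show "runs (scan_body B tk) (conf w i (s i)) (scan_cost B ?l ?n) (conf w (Suc i) (s (Suc i)))"
      using runs_scan_body[OF tk \<open>i < ?n\<close> bounded[of i]]
      by (simp add: s_def scan_def take_Suc_conv_app_nth)
  qed simp_all
  moreover obtain q out us vs es hs where s: "s ?n = (q, out, us, vs, es, hs)" by (metis prod_cases6)
  \<comment> \<open>The initial control state 0 coincides with the blank, so an empty tape already
    stores it.\<close>
  moreover have "((\<lambda>_. 0)(0 := 0), 0) = tape_at [] 0"
    by (auto simp: tape_at_def word_tape_def)
  then have "conf w 0 (s 0) = word_tape w # replicate 6 (word_tape [])"
    by (simp add: s_def scan_def conf.simps word_tape_eq eval_nat_numeral del: fun_upd_apply)
  ultimately have loop: "runs (Loop (\<lambda>ss. ss ! 0 \<noteq> 0) (scan_body B tk))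
      (word_tape w # replicate 6 (word_tape [])) (?n * Suc (scan_cost B ?l ?n) + 1)
      (conf w ?n (q, out, us, vs, es, hs))"
    by simp
  let ?S = "((\<lambda>_. 0)(0 := q), 0) :: tape"
  let ?c = "\<lambda>x hs. [x, reg out, reg us, reg vs, reg es, reg hs, ?S]"
  have hs: "length hs = B * ?n" and out: "length out \<le> ?n * (?l * Suc ?n)"
    using bounded[of ?n] s by auto
  have "runs (clear 0) (conf w ?n (q, out, us, vs, es, hs)) (2 * ?n + 3) (?c (reg []) hs)"
    using runs_clear[of 0 "conf w ?n (q, out, us, vs, es, hs)" w]
    by (simp add: conf.simps)
  moreover have "runs (put 5 False) (?c (reg []) hs) 1 (?c (reg []) (hs @ [False]))"
    using runs_put[of "?c (reg []) hs" 5 hs False] by simp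
  moreover have "runs (append_to 0 5) (?c (reg []) (hs @ [False])) (5 * (B * ?n + 1) + 4)
      (?c (reg (hs @ [False])) (hs @ [False]))"
    using runs_append_to[of 0 "?c (reg []) (hs @ [False])" 5 "[]" "hs @ [False]"] hs by simp
  moreover have "runs (append_to 0 1) (?c (reg (hs @ [False])) (hs @ [False]))
      (5 * (?n * (?l * Suc ?n)) + 4) (?c (reg (hs @ [False] @ out)) (hs @ [False]))"
    using runs_append_to[of 0 "?c (reg (hs @ [False])) (hs @ [False])" 1 "hs @ [False]" out] out
    by (auto intro: runs_mono)
  moreover have "runs (rewind 0) (?c (reg (hs @ [False] @ out)) (hs @ [False]))
      (2 * (B * ?n + 1 + ?n * (?l * Suc ?n)) + 3) (?c (tape_at (hs @ [False] @ out) 0) (hs @ [False]))"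
    using runs_rewind[of 0 "?c (reg (hs @ [False] @ out)) (hs @ [False])" "hs @ [False] @ out"] hs out
    by (auto intro: runs_mono)
  ultimately have "runs (scan_prog B tk) (word_tape w # replicate 6 (word_tape []))
      (?n * Suc (scan_cost B ?l ?n) + 1 + (2 * ?n + 3 + (1 +
        (5 * (B * ?n + 1) + 4 + (5 * (?n * (?l * Suc ?n)) + 4 +
          (2 * (B * ?n + 1 + ?n * (?l * Suc ?n)) + 3))))))
      (?c (tape_at (hs @ [False] @ out) 0) (hs @ [False]))"
    unfolding scan_prog_def using loop by (intro runs_Seq)
  moreover have "scan_word B tk w = hs @ [False] @ out"
    using s by (simp add: scan_word_def s_def)
  ultimately show ?thesis
    by (intro exI[of _ "?c (tape_at (hs @ [False] @ out) 0) (hs @ [False])"]) (simp add: word_tape_eq)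
qed

lemma poly_time_scan_word:
  assumes tk: "\<And>j. Reg j \<in> set tk \<Longrightarrow> j \<in> {2, 3, 4}"
  shows "poly_time (scan_word B tk)"
proof (rule poly_time_prog)
  \<comment> \<open>\<open>?P\<close> copies the bound of \<open>runs_scan_prog\<close> summand by
    summand, with \<open>?cost\<close> for \<open>scan_cost\<close> and \<open>?out\<close> for the
    length of the facts.\<close>
  let ?X = "[:0, 1:] :: nat poly" and ?l = "length tk"
  let ?cost = "[:B + ?l:] * [:4, 5:] + [:20, 4:]" and ?out = "?X * ([:?l:] * [:1, 1:])"
  let ?P = "?X * (1 + ?cost) + 1 + ([:3, 2:] + (1 + ([:5:] * ([:B:] * ?X + 1) + [:4:] + ([:5:] * ?out + [:4:] +
    ([:2:] * ([:B:] * ?X + 1 + ?out) + [:3:])))))"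
  show "\<exists>ts. runs (scan_prog B tk) (word_tape w # replicate (7 - 1) (word_tape [])) (poly ?P (length w)) ts \<and>
    ts ! 0 = word_tape (scan_word B tk w)" for w
    using runs_scan_prog[OF tk, where B = B and w = w] by (simp add: scan_cost_def algebra_simps)
  have "j < 7" if "Reg j \<in> set tk" for j using tk[OF that] by auto
  then have "well_formed 7 4 (emit 1 tk)" "well_formed 7 4 (emit 5 (replicate B (Bit True)))"
    by (auto intro!: well_formed_emit)
  then show "well_formed 7 4 (scan_prog B tk)"
    by (auto simp: scan_prog_def scan_body_def goto_def skip_def clear_def put_def append_to_def
        rewind_def tuples_def subset_eq)
qed simp_all


section \<open>The output on an encoded digraph\<close>

lemma foldl_scan_step_nat_word:
  "foldl (scan_step B tk) (0, out, us, vs, es, hs) (nat_word n) =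
     (1, out, us, vs, es, hs @ replicate (B * Suc n) True)"
  by (induction n arbitrary: hs) (simp_all add: nat_word_def Let_def replicate_add)

text \<open>The bit for the index 0 empties the registers of the ends, so their old contents
  \<open>us\<close> and \<open>vs\<close> are arbitrary. The fact has 1 + (u + 1) + (v + 1) bits,
  which gives \<open>u + v + 3\<close> in the header.\<close>

lemma foldl_scan_step_fact_word:
  "foldl (scan_step B tk) (1, out, us, vs, es, hs) (fact_word (0, [u, v])) =
     (1, out @ expand (scan_regs (replicate u True) (replicate v True) es) tk,
      replicate u True, replicate v True, es @ [True], hs @ replicate (B * (u + v + 3)) True)"
proof -
  have 1: "foldl (scan_step B tk) (2, out, us, vs, es, hs) (nat_word n) =
     (3, out, us @ replicate n True, vs, es, hs @ replicate (B * Suc n) True)" for us vs hs n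
    by (induction n arbitrary: us hs) (simp_all add: nat_word_def Let_def replicate_add)
  have 2: "foldl (scan_step B tk) (3, out, us, vs, es, hs) (nat_word n) =
     (1, out @ expand (scan_regs us (vs @ replicate n True) es) tk, us, vs @ replicate n True,
      es @ [True], hs @ replicate (B * Suc n) True)" for us vs hs n
    by (induction n arbitrary: vs hs) (simp_all add: nat_word_def Let_def replicate_add)
  have 0: "scan_step B tk (1, out, us, vs, es, hs) False = (2, out, [], [], es, hs @ replicate B True)"
    by (simp add: Let_def)
  have "fact_word (0, [u, v]) = False # nat_word u @ nat_word v"
    by (simp add: fact_word_def nat_word_def)
  moreover have "B * (u + v + 3) = B + (B * Suc u + B * Suc v)" by (simp add: algebra_simps)
  ultimately show ?thesis
    by (simp only: foldl_Cons foldl_append 0 1 2 append_Nil append_assoc replicate_add)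
qed

abbreviation edge_word :: "nat \<times> nat \<Rightarrow> bool list" where
  "edge_word \<equiv> (\<lambda>(u, v). fact_word (0, [u, v]))"

lemma foldl_scan_step_edges:
  "\<exists>us' vs' es' hs'. foldl (scan_step B tk) (1, out, us, vs, replicate k True, hs) (concat (map edge_word E)) =
     (1, out @ concat (map (\<lambda>(k, u, v). expand
        (scan_regs (replicate u True) (replicate v True) (replicate k True)) tk) (List.enumerate k E)), us', vs', es', hs')"
proof (induction E arbitrary: out us vs k hs)
  case (Cons uv E)
  obtain u v where "uv = (u, v)" by fastforce
  then show ?case
    using Cons.IH[of "out @ expand (scan_regs (replicate u True) (replicate v True) (replicate k True)) tk"
        "replicate u True" "replicate v True" "Suc k" "hs @ replicate (B * (u + v + 3)) True"]
    by (simp add: foldl_scan_step_fact_word replicate_append_same del: scan_step.simps One_nat_def)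
qed simp

lemma scan_word_edges:
  assumes "w = nat_word n @ concat (map edge_word E)"
  shows "scan_word B tk w = nat_word (B * length w) @ concat (map (\<lambda>(k, u, v). expand
      (scan_regs (replicate u True) (replicate v True) (replicate k True)) tk) (List.enumerate 0 E))"
proof -
  obtain us vs es hs where s: "scan B tk w =
    (1, concat (map (\<lambda>(k, u, v). expand
      (scan_regs (replicate u True) (replicate v True) (replicate k True)) tk) (List.enumerate 0 E)), us, vs, es, hs)"
    using foldl_scan_step_edges[of B tk "[]" "[]" "[]" 0 "replicate (B * Suc n) True" E]
    by (auto simp: scan_def assms foldl_scan_step_nat_word simp del: scan_step.simps mult_Suc_right)
  \<comment> \<open>The header depends on the number of bits read only, so the invariant yields it
    without following it through the edges.\<close>
  moreover have "hs = replicate (B * length w) True"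
    using scan_bounded_scan[of B tk w] s by simp
  ultimately show ?thesis by (simp add: scan_word_def nat_word_def)
qed

text \<open>
  A template fact has entries \<open>(j, c)\<close>, standing for the number \<open>B * r + c\<close> with \<open>r\<close> the content of
  the register \<open>j\<close> and \<open>r = 0\<close> for \<open>j = 0\<close>.
\<close>

definition entry_tokens :: "nat \<Rightarrow> nat \<times> nat \<Rightarrow> token list" where
  "entry_tokens B = (\<lambda>(j, c). (if j = 0 then [] else replicate B (Reg j)) @ replicate c (Bit True) @ [Bit False])"

definition fact_tokens :: "nat \<Rightarrow> nat \<times> (nat \<times> nat) list \<Rightarrow> token list" where
  "fact_tokens B = (\<lambda>(i, xs). replicate i (Bit True) @ Bit False # concat (map (entry_tokens B) xs))"

fun entry_value :: "nat \<Rightarrow> nat \<times> nat \<times> nat \<Rightarrow> nat \<times> nat \<Rightarrow> nat" where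
  "entry_value B (k, u, v) (j, c) =
     B * (if j = 0 then 0 else if j = 2 then u else if j = 3 then v else k) + c"

definition template_facts :: "nat \<Rightarrow> (nat \<times> (nat \<times> nat) list) list \<Rightarrow> (nat \<times> nat) list \<Rightarrow> (nat \<times> nat list) list" where
  "template_facts B F E =
     concat (map (\<lambda>e. map (\<lambda>(i, xs). (i, map (entry_value B e) xs)) F) (List.enumerate 0 E))"

text \<open>In unary, multiplication by the constant \<open>B\<close> amounts to \<open>B\<close>
  copies of a register.\<close>

lemma expand_entry_tokens:
  "expand (scan_regs (replicate u True) (replicate v True) (replicate k True)) (entry_tokens B x) =
     nat_word (entry_value B (k, u, v) x)"
proof -
  have "expand r (replicate m (Reg j)) = replicate (m * n) True" if "r j = replicate n True" for r j m n
    using that by (induction m) (simp_all add: replicate_add)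
  then show ?thesis
    by (cases x) (simp add: entry_tokens_def nat_word_def replicate_add scan_regs_def)
qed

lemma expand_fact_tokens:
  "expand (scan_regs (replicate u True) (replicate v True) (replicate k True)) (fact_tokens B (i, xs)) =
     fact_word (i, map (entry_value B (k, u, v)) xs)"
proof -
  have "expand (scan_regs (replicate u True) (replicate v True) (replicate k True)) (concat (map (entry_tokens B) xs))
      = concat (map nat_word (map (entry_value B (k, u, v)) xs))"
    by (induction xs) (simp_all add: expand_entry_tokens)
  then show ?thesis by (simp add: fact_tokens_def fact_word_def nat_word_def)
qed

text \<open>This is the interface to the machines: below it the reduction is a matter of template
  facts.\<close>

lemma template_reduction:
  assumes F: "\<forall>(i, xs)\<in>set F. fst ` set xs \<subseteq> {0, 2, 3, 4}"
  obtains f where "poly_time f"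
    and "\<And>w n E. w = nat_word n @ concat (map edge_word E) \<Longrightarrow>
           f w = nat_word (B * length w) @ concat (map fact_word (template_facts B F E))"
proof -
  let ?tk = "concat (map (fact_tokens B) F)"
  let ?r = "\<lambda>k u v. scan_regs (replicate u True) (replicate v True) (replicate k True)"
  have "j \<in> {2, 3, 4}" if "Reg j \<in> set ?tk" for j
    using that F by (fastforce simp: fact_tokens_def entry_tokens_def split: if_splits)
  then have "poly_time (scan_word B ?tk)"
    by (rule poly_time_scan_word)
  moreover have *: "expand (?r k u v) ?tk = concat (map fact_word (map (\<lambda>(i, xs). (i, map (entry_value B (k, u, v)) xs)) F))"
    for k u v
    by (induction F) (auto simp: expand_fact_tokens simp del: entry_value.simps)
  then have "scan_word B ?tk w = nat_word (B * length w) @ concat (map fact_word (template_facts B F E))"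
    if "w = nat_word n @ concat (map edge_word E)" for w n E
  proof -
    have "concat (map fact_word (template_facts B F E)) = concat (map (\<lambda>(k, u, v). expand (?r k u v) ?tk) es)"
      if "template_facts B F E = concat (map (\<lambda>e. map (\<lambda>(i, xs). (i, map (entry_value B e) xs)) F) es)" for es
      unfolding that by (induction es) (use * in auto)
    then show ?thesis
      unfolding scan_word_edges[OF that] by (simp add: template_facts_def)
  qed
  ultimately show thesis by (rule that)
qed


section \<open>Compactness\<close>

lemma finite_tuples: "finite S \<Longrightarrow> finite (tuples k S)"
  using finite_lists_length_eq[of S k] by (simp add: tuples_def conj_commute)

lemma countable_tuples: "countable S \<Longrightarrow> countable (tuples k S)"
  by (rule countable_subset[of _ "lists S"]) (auto simp: tuples_def)

lemma tuples_mono: "S \<subseteq> T \<Longrightarrow> tuples k S \<subseteq> tuples k T"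
  by (auto simp: tuples_def)

section \<open>Permutation groups, limits modulo orbits and pointwise closure\<close>

locale perm_group =
  fixes S :: "'a set" and G :: "('a \<Rightarrow> 'a) set"
  assumes subgroup: "subgroup G (BijGroup S)"
begin

lemma closed: "g \<in> G \<Longrightarrow> x \<in> S \<Longrightarrow> g x \<in> S"
  using subgroup.subset[OF subgroup] by (auto simp: BijGroup_def Bij_def bij_betw_def)

lemma PiE: "g \<in> G \<Longrightarrow> g \<in> S \<rightarrow>\<^sub>E S"
  using subgroup.subset[OF subgroup] closed by (auto simp: BijGroup_def Bij_def PiE_def)

lemma ident: "\<exists>g\<in>G. \<forall>x\<in>S. g x = x"
  using subgroup.one_closed[OF subgroup] by (intro bexI[of _ "\<one>\<^bsub>BijGroup S\<^esub>"]) (auto simp: BijGroup_def)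

lemma comp:
  assumes "g \<in> G" and "h \<in> G"
  shows "\<exists>k\<in>G. \<forall>x\<in>S. k x = g (h x)"
proof -
  have "g \<in> Bij S" "h \<in> Bij S"
    using assms subgroup.subset[OF subgroup] by (auto simp: BijGroup_def)
  then have "compose S g h \<in> G"
    using subgroup.m_closed[OF subgroup assms] by (simp add: BijGroup_def)
  then show ?thesis by (intro bexI[of _ "compose S g h"]) (auto simp: compose_eq)
qed

lemma inverse:
  assumes "g \<in> G"
  shows "\<exists>h\<in>G. \<forall>x\<in>S. h (g x) = x"
proof -
  have g: "g \<in> Bij S" using assms subgroup.subset[OF subgroup] by (auto simp: BijGroup_def)
  have "restrict (inv_into S g) S \<in> G"
    using subgroup.m_inv_closed[OF subgroup assms] inv_BijGroup[OF g] by simp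
  moreover have "restrict (inv_into S g) S (g x) = x" if "x \<in> S" for x
    using g that closed[OF assms that] by (simp add: Bij_def bij_betw_def)
  ultimately show ?thesis by blast
qed

lemma orbit_mem: "t \<in> tuples k S \<Longrightarrow> t \<in> {map g t | g. g \<in> G}"
  using ident by (force simp: tuples_def subset_eq intro: map_idI[symmetric])

text \<open>
  Along suitable indices, the orbits of all initial segments of the sequences \<open>\<phi> n\<close> stabilise; the
  limit is corrected by a group element at every stage.
\<close>

lemma orbit_limit:
  fixes \<phi> :: "nat \<Rightarrow> nat \<Rightarrow> 'a"
  assumes olig: "oligomorphic S G" and \<phi>: "\<And>n i. \<phi> n i \<in> S"
  obtains \<psi> where "\<And>i. \<psi> i \<in> S"
    and "\<And>I m. finite I \<Longrightarrow> \<exists>n\<ge>m. \<exists>g\<in>G. \<forall>i\<in>I. \<psi> i = g (\<phi> n i)"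
proof -
  define row where "row n k = map (\<phi> n) [0..<k]" for n k
  have row: "row n k \<in> tuples k S" for n k
    using \<phi> by (auto simp: row_def tuples_def)
  define P where "P k p \<longleftrightarrow> infinite {n. \<exists>g\<in>G. p = map g (row n k)}" for k p
  have "\<exists>f. \<forall>k. P k (f k) \<and> (\<exists>x\<in>S. f (Suc k) = f k @ [x])"
  proof (rule dependent_nat_choice)
    have "G \<noteq> {}" using ident by auto
    then show "\<exists>p. P 0 p" by (auto simp: P_def row_def intro!: exI[of _ "[]"])
  next
    fix p k
    assume "P k p"
    define orb where "orb n = {map g (row n (Suc k)) | g. g \<in> G}" for n
    let ?N = "{n. \<exists>g\<in>G. p = map g (row n k)}"
    have "finite {{map g t | g. g \<in> G} | t. t \<in> tuples (Suc k) S}"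
      using olig by (simp add: oligomorphic_def)
    then have "finite (orb ` ?N)"
      by (rule finite_subset[rotated]) (use row in \<open>auto simp: orb_def\<close>)
    \<comment> \<open>\<open>?N\<close> is infinite and only finitely many orbits are available, so
      one orbit occurs for infinitely many indices. \<open>a\<close> is such an index; the element
      \<open>h\<close> matching its row with \<open>p\<close> also supplies the next entry
      \<open>?x\<close>.\<close>
    then obtain a where a: "a \<in> ?N" "infinite {b \<in> ?N. orb b = orb a}"
      using pigeonhole_infinite[of ?N orb] \<open>P k p\<close> by (auto simp: P_def)
    obtain h where h: "h \<in> G" "p = map h (row a k)" using a(1) by auto
    let ?x = "h (\<phi> a k)"
    have "\<exists>g\<in>G. p @ [?x] = map g (row b (Suc k))" if "orb b = orb a" for b
    proof -
      have "row a (Suc k) \<in> orb b"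
        using orbit_mem[OF row[of a "Suc k"]] that by (simp add: orb_def)
      then obtain g where g: "g \<in> G" "row a (Suc k) = map g (row b (Suc k))"
        by (auto simp: orb_def)
      obtain hg where hg: "hg \<in> G" "\<forall>x\<in>S. hg x = h (g x)" using comp[OF h(1) g(1)] by auto
      have "p @ [?x] = map h (row a (Suc k))" using h by (simp add: row_def)
      also have "\<dots> = map hg (row b (Suc k))"
        using g(2) hg(2) row[of b "Suc k"] by (auto simp: tuples_def)
      finally show ?thesis using hg(1) by blast
    qed
    then have "{b \<in> ?N. orb b = orb a} \<subseteq> {b. \<exists>g\<in>G. p @ [?x] = map g (row b (Suc k))}"
      by blast
    then have "P (Suc k) (p @ [?x])"
      using infinite_super a(2) unfolding P_def by blast
    moreover have "?x \<in> S" using closed h \<phi> by simp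
    ultimately show "\<exists>q. P (Suc k) q \<and> (\<exists>x\<in>S. q = p @ [x])" by blast
  qed
  then obtain f where f: "\<And>k. P k (f k)" "\<And>k. \<exists>x\<in>S. f (Suc k) = f k @ [x]" by blast
  define \<psi> where "\<psi> i = last (f (Suc i))" for i
  have "f k = map \<psi> [0..<k]" for k
  proof (induction k)
    case 0
    have "{n. \<exists>g\<in>G. f 0 = map g (row n 0)} \<noteq> {}"
      using f(1)[of 0] unfolding P_def by (metis finite.emptyI)
    then show ?case by (auto simp: row_def)
  next
    case (Suc k)
    then show ?case using f(2)[of k] by (auto simp: \<psi>_def)
  qed
  then have inf: "infinite {n. \<exists>g\<in>G. \<forall>i<k. \<psi> i = g (\<phi> n i)}" for k
    using f(1)[of k] by (simp add: P_def row_def Ball_def)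
  show thesis
  proof (rule that)
    show "\<psi> i \<in> S" for i using f(2)[of i] by (auto simp: \<psi>_def)
    fix I :: "nat set" and m
    assume "finite I"
    then obtain k where k: "\<forall>i\<in>I. i < k" using finite_nat_set_iff_bounded by blast
    obtain n where "n \<ge> m" "\<exists>g\<in>G. \<forall>i<k. \<psi> i = g (\<phi> n i)"
      using inf[of k] unfolding infinite_nat_iff_unbounded_le by blast
    then show "\<exists>n\<ge>m. \<exists>g\<in>G. \<forall>i\<in>I. \<psi> i = g (\<phi> n i)" using k by blast
  qed
qed

text \<open>A basic open set in a product of discrete spaces restricts finitely many coordinates, so
  approximation on finite sets suffices.\<close>

lemma pointwise_closureI:
  assumes u: "u \<in> S \<rightarrow>\<^sub>E S" and "\<And>E. finite E \<Longrightarrow> E \<subseteq> S \<Longrightarrow> \<exists>g\<in>G. \<forall>x\<in>E. u x = g x"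
  shows "u \<in> pointwise_closure S G"
  unfolding pointwise_closure_def in_closure_of
proof (intro conjI allI impI)
  show "u \<in> topspace (product_topology (\<lambda>_. discrete_topology S) S)" using u by simp
  fix T
  assume "u \<in> T \<and> openin (product_topology (\<lambda>_. discrete_topology S) S) T"
  then obtain U where U: "finite {i \<in> S. U i \<noteq> S}" "u \<in> PiE S U" "PiE S U \<subseteq> T"
    by (auto simp: openin_product_topology_alt)
  obtain g where g: "g \<in> G" "\<forall>x\<in>{i \<in> S. U i \<noteq> S}. u x = g x"
    using assms(2)[OF U(1)] by auto
  have "g x \<in> U x" if "x \<in> S" for x
  proof (cases "U x = S")
    case True
    then show ?thesis using closed[OF g(1) that] by simp
  next
    case False
    then have "g x = u x" using g(2) that by simp
    then show ?thesis using PiE_mem[OF U(2) that] by simp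
  qed
  then have "g \<in> PiE S U" using PiE[OF g(1)] by (auto simp: PiE_def)
  then show "\<exists>y. y \<in> G \<and> y \<in> T" using U(3) g(1) by blast
qed

end

text \<open>The last clause says that the tuples of values of \<open>f\<close> on the two sides,
  indexed by all triples from \<open>D\<close>, lie in one orbit. A separate \<open>g\<close> for
  every triple would not give this.\<close>

definition local_siggers :: "'a rel_struct \<Rightarrow> ('a \<Rightarrow> 'a) set \<Rightarrow> 'a set \<Rightarrow> bool" where
  "local_siggers C G D \<longleftrightarrow> (\<exists>f\<in>tuples 6 D \<rightarrow> universe C.
     (\<forall>i<length (signature C). \<forall>ts\<in>rel (power_struct 6 C) i.
        set ts \<subseteq> tuples 6 D \<longrightarrow> map f ts \<in> rel C i) \<and>
     (\<exists>g\<in>G. \<forall>x\<in>D. \<forall>y\<in>D. \<forall>z\<in>D. f [x, y, x, z, y, z] = g (f [y, x, z, x, z, y])))"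

text \<open>Two limits are needed. The first, of the local functions, gives \<open>s\<close>, which
  on every finite set is a local function followed by an element of \<open>G\<close>. Hence on each
  finite set the identity holds for \<open>s\<close> up to an element of \<open>G\<close>, but these
  elements vary with the set and need not converge. The second limit, of the pairs of the identity
  map and \<open>g' n\<close>, corrected by common elements of \<open>G\<close>, gives
  \<open>u\<close> and \<open>v\<close>.\<close>

lemma siggers_modulo_compact:
  assumes C: "rel_structure C" and G: "subgroup G (BijGroup (universe C))" "G \<subseteq> Aut C"
    and olig: "oligomorphic (universe C) G"
    and loc: "\<And>D. finite D \<Longrightarrow> D \<subseteq> universe C \<Longrightarrow> local_siggers C G D"
  shows "siggers_modulo C (pointwise_closure (universe C) G)"
proof -
  define S where "S = universe C"
  interpret perm_group S G using G(1) by (intro perm_group.intro) (simp add: S_def)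
  have cS: "countable S" using C by (simp add: rel_structure_def S_def)
  have G_homs: "map g t \<in> rel C i" if "g \<in> G" "t \<in> rel C i" "i < length (signature C)" for g t i
    using that G(2) by (auto simp: Aut_def homs_def)
  show ?thesis
  \<comment> \<open>The enumeration of \<open>S\<close> in the other case needs an element. Over the
    empty set only the empty tuple in nullary relations remains to be checked.\<close>
  proof (cases "S = {}")
    case True
    obtain f where f: "\<forall>i<length (signature C). \<forall>ts\<in>rel (power_struct 6 C) i.
        set ts \<subseteq> tuples 6 {} \<longrightarrow> map f ts \<in> rel C i"
      using loc[of "{}"] by (auto simp: local_siggers_def)
    have e: "tuples 6 ({} :: 'a set) = {}" by (auto simp: tuples_def)
    have "map (\<lambda>_. undefined) ts \<in> rel C i"
      if "i < length (signature C)" "ts \<in> rel (power_struct 6 C) i" for i ts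
    proof -
      have "set ts \<subseteq> tuples 6 {}" using that True by (auto simp: power_struct_def S_def tuples_def)
      then show ?thesis using f that e by auto
    qed
    then have "(\<lambda>_. undefined) \<in> Pol 6 C"
      using True e by (simp add: Pol_def homs_def S_def) (simp add: power_struct_def)
    moreover obtain g where "g \<in> G" using ident by auto
    then have "g \<in> pointwise_closure S G"
      using PiE True by (intro pointwise_closureI) auto
    ultimately show ?thesis using True unfolding siggers_modulo_def S_def by fastforce
  next
    case False
    define e where "e = from_nat_into S"
    define c where "c = to_nat_on S"
    have e: "e i \<in> S" for i using False by (simp add: e_def from_nat_into)
    have ec: "e (c x) = x" if "x \<in> S" for x
      using that cS by (simp add: e_def c_def)
    define D where "D n = e ` {..n}" for n :: nat
    have D: "finite (D n)" "D n \<subseteq> S" for n using e by (auto simp: D_def)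
    have exhaust: "\<exists>m. \<forall>n\<ge>m. E \<subseteq> D n" if "finite E" "E \<subseteq> S" for E
    proof -
      obtain m where m: "\<forall>x\<in>c ` E. x \<le> m"
        using \<open>finite E\<close> finite_nat_set_iff_bounded_le by blast
      have "x \<in> D n" if "x \<in> E" "n \<ge> m" for x n
        using m that \<open>E \<subseteq> S\<close> ec[of x] unfolding D_def by (intro image_eqI[of _ _ "c x"]) auto
      then show ?thesis by blast
    qed
    have "\<forall>n. \<exists>f g. f \<in> tuples 6 (D n) \<rightarrow> S \<and> g \<in> G \<and>
      (\<forall>i<length (signature C). \<forall>ts\<in>rel (power_struct 6 C) i.
        set ts \<subseteq> tuples 6 (D n) \<longrightarrow> map f ts \<in> rel C i) \<and>
      (\<forall>x\<in>D n. \<forall>y\<in>D n. \<forall>z\<in>D n. f [x, y, x, z, y, z] = g (f [y, x, z, x, z, y]))"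
      using loc[OF D[unfolded S_def]] unfolding local_siggers_def S_def by blast
    then obtain f g where fS: "\<And>n. f n \<in> tuples 6 (D n) \<rightarrow> S" and gG: "\<And>n. g n \<in> G"
      and f_rel: "\<And>n i ts. i < length (signature C) \<Longrightarrow> ts \<in> rel (power_struct 6 C) i \<Longrightarrow>
        set ts \<subseteq> tuples 6 (D n) \<Longrightarrow> map (f n) ts \<in> rel C i"
      and fg: "\<And>n x y z. x \<in> D n \<Longrightarrow> y \<in> D n \<Longrightarrow> z \<in> D n \<Longrightarrow>
        f n [x, y, x, z, y, z] = g n (f n [y, x, z, x, z, y])"
      by metis
    let ?J = "tuples 6 S"
    have cJ: "countable ?J" by (rule countable_tuples[OF cS])
    \<comment> \<open>The default \<open>e 0\<close> keeps the sequence in \<open>S\<close>. It does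
      not affect the limit, since every finite set lies in \<open>D n\<close> for large
      \<open>n\<close> and \<open>\<psi>_lim\<close> provides large \<open>n\<close>.\<close>
    define \<phi> where "\<phi> n i = (let t = from_nat_into ?J i in if t \<in> tuples 6 (D n) then f n t else e 0)" for n i
    have "\<phi> n i \<in> S" for n i using fS e by (auto simp: \<phi>_def Let_def)
    from orbit_limit[OF olig[folded S_def], of \<phi>, OF this] obtain \<psi> where \<psi>: "\<And>i. \<psi> i \<in> S"
      and \<psi>_lim: "\<And>I m. finite I \<Longrightarrow> \<exists>n\<ge>m. \<exists>g\<in>G. \<forall>i\<in>I. \<psi> i = g (\<phi> n i)" by blast
    define s where "s = (\<lambda>t\<in>?J. \<psi> (to_nat_on ?J t))"
    have s_lim: "\<exists>n. \<exists>h\<in>G. E \<subseteq> D n \<and> (\<forall>t\<in>tuples 6 E. s t = h (f n t))"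
      if E: "finite E" "E \<subseteq> S" for E
    proof -
      obtain m where m: "\<forall>n\<ge>m. E \<subseteq> D n" using exhaust E by blast
      obtain n h where n: "n \<ge> m" "h \<in> G" "\<forall>i\<in>to_nat_on ?J ` tuples 6 E. \<psi> i = h (\<phi> n i)"
        using \<psi>_lim[of "to_nat_on ?J ` tuples 6 E" m] finite_tuples[OF E(1)] by auto
      have "s t = h (f n t)" if "t \<in> tuples 6 E" for t
      proof -
        have "t \<in> ?J" "t \<in> tuples 6 (D n)"
          using that m n(1) E tuples_mono by blast+
        then show ?thesis using n(3) that cJ by (simp add: s_def \<phi>_def)
      qed
      then show ?thesis using m n by blast
    qed
    have "s \<in> Pol 6 C"
    proof -
      have "map s ts \<in> rel C i" if "i < length (signature C)" "ts \<in> rel (power_struct 6 C) i" for i ts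
      proof -
        let ?E = "\<Union> (set ` set ts)"
        have ts: "set ts \<subseteq> ?J" using that(2) by (auto simp: power_struct_def tuples_def S_def)
        then have "?E \<subseteq> S" by (auto simp: tuples_def)
        then obtain n h where n: "h \<in> G" "?E \<subseteq> D n" "\<forall>t\<in>tuples 6 ?E. s t = h (f n t)"
          using s_lim[of ?E] by auto
        have ts': "set ts \<subseteq> tuples 6 ?E" using ts by (auto simp: tuples_def)
        have "map h (map (f n) ts) = map s ts" using n(3) ts' by auto
        moreover have "map (f n) ts \<in> rel C i"
          using f_rel that ts' tuples_mono[OF n(2)] by blast
        ultimately show ?thesis using G_homs n(1) that(1) by metis
      qed
      moreover have "s \<in> ?J \<rightarrow>\<^sub>E S" using \<psi> by (simp add: s_def)
      ultimately show ?thesis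
        unfolding Pol_def homs_def S_def by (simp add: power_struct_def)
    qed
    have "\<exists>g\<in>G. \<forall>x\<in>E. \<forall>y\<in>E. \<forall>z\<in>E. s [x, y, x, z, y, z] = g (s [y, x, z, x, z, y])"
      if E: "finite E" "E \<subseteq> S" for E
    proof -
      obtain n h where n: "h \<in> G" "E \<subseteq> D n" "\<forall>t\<in>tuples 6 E. s t = h (f n t)"
        using s_lim[OF E] by blast
      obtain h' where h': "h' \<in> G" "\<forall>x\<in>S. h' (h x) = x" using inverse[OF n(1)] by blast
      obtain k where k: "k \<in> G" "\<forall>x\<in>S. k x = h (g n x)" using comp[OF n(1) gG] by blast
      \<comment> \<open>\<open>l\<close> is the conjugate of \<open>g n\<close> by \<open>h\<close>;
        it carries the identity from \<open>f n\<close> over to \<open>s\<close>.\<close>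
      obtain l where l: "l \<in> G" "\<forall>x\<in>S. l x = k (h' x)" using comp[OF k(1) h'(1)] by blast
      have "s [x, y, x, z, y, z] = l (s [y, x, z, x, z, y])" if "x \<in> E" "y \<in> E" "z \<in> E" for x y z
      proof -
        let ?b = "[y, x, z, x, z, y]"
        have b: "?b \<in> tuples 6 E" "[x, y, x, z, y, z] \<in> tuples 6 E" using that by (auto simp: tuples_def)
        then have fb: "f n ?b \<in> S" using fS[of n] tuples_mono[OF n(2)] by blast
        have "s [x, y, x, z, y, z] = h (g n (f n ?b))"
          using n b fg[of x n y z] that by (simp add: subset_iff)
        also have "\<dots> = l (s ?b)"
          using b n k l h' fb closed[OF n(1) fb] by simp
        finally show ?thesis .
      qed
      then show ?thesis using l(1) by blast
    qed
    then have "\<forall>n. \<exists>g\<in>G. \<forall>x\<in>D n. \<forall>y\<in>D n. \<forall>z\<in>D n. s [x, y, x, z, y, z] = g (s [y, x, z, x, z, y])"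
      using D by blast
    then obtain g' where g': "\<And>n. g' n \<in> G"
      and sg: "\<And>n x y z. x \<in> D n \<Longrightarrow> y \<in> D n \<Longrightarrow> z \<in> D n \<Longrightarrow>
        s [x, y, x, z, y, z] = g' n (s [y, x, z, x, z, y])" by metis
    \<comment> \<open>Even positions list the identity map, odd ones \<open>g' n\<close>.
      Interleaving them in one sequence forces a common correction \<open>h\<close> for
      \<open>u\<close> and \<open>v\<close>.\<close>
    define \<chi> where "\<chi> n i = (if even i then e (i div 2) else g' n (e (i div 2)))" for n i
    have "\<chi> n i \<in> S" for n i using closed[OF g'] e by (simp add: \<chi>_def)
    from orbit_limit[OF olig[folded S_def], of \<chi>, OF this] obtain \<theta> where \<theta>: "\<And>i. \<theta> i \<in> S"
      and \<theta>_lim: "\<And>I m. finite I \<Longrightarrow> \<exists>n\<ge>m. \<exists>g\<in>G. \<forall>i\<in>I. \<theta> i = g (\<chi> n i)" by blast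
    define u where "u = (\<lambda>x\<in>S. \<theta> (2 * c x))"
    define v where "v = (\<lambda>x\<in>S. \<theta> (2 * c x + 1))"
    have uv: "\<exists>n. \<exists>h\<in>G. E \<subseteq> D n \<and> (\<forall>x\<in>E. u x = h x \<and> v x = h (g' n x))"
      if E: "finite E" "E \<subseteq> S" for E
    proof -
      obtain m where m: "\<forall>n\<ge>m. E \<subseteq> D n" using exhaust E by blast
      let ?I = "(\<lambda>x. 2 * c x) ` E \<union> (\<lambda>x. 2 * c x + 1) ` E"
      obtain n h where n: "n \<ge> m" "h \<in> G" "\<forall>i\<in>?I. \<theta> i = h (\<chi> n i)"
        using \<theta>_lim[of ?I m] E(1) by auto
      have "u x = h x \<and> v x = h (g' n x)" if "x \<in> E" for x
      proof -
        have "u x = h (\<chi> n (2 * c x))" "v x = h (\<chi> n (2 * c x + 1))"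
          using that E(2) n(3) unfolding u_def v_def by auto
        moreover have "x \<in> S" using that E by blast
        ultimately show ?thesis using ec by (simp add: \<chi>_def)
      qed
      then show ?thesis using m n by blast
    qed
    have "u \<in> pointwise_closure S G"
    proof (rule pointwise_closureI)
      show "u \<in> S \<rightarrow>\<^sub>E S" using \<theta> by (simp add: u_def)
      show "\<exists>g\<in>G. \<forall>x\<in>E. u x = g x" if "finite E" "E \<subseteq> S" for E
        using uv[OF that] by blast
    qed
    moreover have "v \<in> pointwise_closure S G"
    proof (rule pointwise_closureI)
      show "v \<in> S \<rightarrow>\<^sub>E S" using \<theta> by (simp add: v_def)
      fix E assume E: "finite E" "E \<subseteq> S"
      obtain n h where n: "h \<in> G" "\<forall>x\<in>E. v x = h (g' n x)" using uv[OF E] by blast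
      obtain k where k: "k \<in> G" "\<forall>x\<in>S. k x = h (g' n x)" using comp[OF n(1) g'] by blast
      have "v x = k x" if "x \<in> E" for x using n(2) k(2) E(2) that by auto
      then show "\<exists>g\<in>G. \<forall>x\<in>E. v x = g x" using k(1) by blast
    qed
    moreover have "u (s [x, y, x, z, y, z]) = v (s [y, x, z, x, z, y])" if "x \<in> S" "y \<in> S" "z \<in> S" for x y z
    proof -
      let ?a = "[x, y, x, z, y, z]" and ?b = "[y, x, z, x, z, y]"
      have "?a \<in> ?J" "?b \<in> ?J" using that by (auto simp: tuples_def)
      then have "s ?a \<in> S" "s ?b \<in> S" using \<psi> by (simp_all add: s_def)
      \<comment> \<open>The finite set contains the triple, for \<open>sg\<close>, and both values
        of \<open>s\<close>, on which \<open>u\<close> acts as \<open>h\<close> and \<open>v\<close>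
        as \<open>g' n\<close> followed by \<open>h\<close>.\<close>
      then obtain n h where "h \<in> G" "{x, y, z, s ?a, s ?b} \<subseteq> D n"
        "\<forall>x\<in>{x, y, z, s ?a, s ?b}. u x = h x \<and> v x = h (g' n x)"
        using uv[of "{x, y, z, s ?a, s ?b}"] \<open>x \<in> S\<close> \<open>y \<in> S\<close> \<open>z \<in> S\<close> by auto
      then show ?thesis using sg[of x n y z] by auto
    qed
    ultimately show ?thesis
      using \<open>s \<in> Pol 6 C\<close> unfolding siggers_modulo_def S_def by blast
  qed
qed


section \<open>The gadget\<close>

abbreviation siggers_left :: "'a \<Rightarrow> 'a \<Rightarrow> 'a \<Rightarrow> 'a list" where
  "siggers_left x y z \<equiv> [x, y, x, z, y, z]"

abbreviation siggers_right :: "'a \<Rightarrow> 'a \<Rightarrow> 'a \<Rightarrow> 'a list" where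
  "siggers_right x y z \<equiv> [y, x, z, x, z, y]"

text \<open>The six coordinates of the Siggers identity run through the six edges of \<open>K 3\<close>.\<close>

lemma siggers_coordinate:
  assumes "p < 3" and "q < 3" and "p \<noteq> q"
  shows "\<exists>j<6. \<forall>x y z. siggers_left x y z ! j = [x, y, z] ! p \<and> siggers_right x y z ! j = [x, y, z] ! q"
proof -
  consider "p = 0" "q = 1" | "p = 1" "q = 0" | "p = 0" "q = 2" | "p = 2" "q = 0" | "p = 1" "q = 2" | "p = 2" "q = 1"
  proof -
    have "p = 0 \<or> p = 1 \<or> p = 2" "q = 0 \<or> q = 1 \<or> q = 2" using assms by linarith+
    then show thesis using that assms(3) by blast
  qed
  then show ?thesis
  proof cases
    case 1 then show ?thesis by (intro exI[of _ 0]) simp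
  next
    case 2 then show ?thesis by (intro exI[of _ 1]) simp
  next
    case 3 then show ?thesis by (intro exI[of _ 2]) simp
  next
    case 4 then show ?thesis by (intro exI[of _ 3]) simp
  next
    case 5 then show ?thesis by (intro exI[of _ 4]) simp
  next
    case 6 then show ?thesis by (intro exI[of _ 5]) simp
  qed
qed

locale siggers_gadget =
  fixes C :: "'a rel_struct" and D :: "'a set"
  assumes D: "finite D" "D \<noteq> {}" "D \<subseteq> universe C"
begin

definition T :: "'a list set" where
  "T = tuples 6 D"

definition B :: nat where
  "B = card T"

definition code :: "'a list \<Rightarrow> nat" where
  "code = (SOME f. bij_betw f T {..<B})"

definition decode :: "nat \<Rightarrow> 'a list" where
  "decode = inv_into T code"

text \<open>
  Registers 2 and 3 hold the ends of an edge and register 4 its index. The variables of a vertex are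
  the non-constant \<open>siggers_left x y z\<close>; a constant tuple belongs to both sides of the identity and is
  shared by the whole instance, which avoids a quotient.
\<close>

definition entry :: "'a list \<Rightarrow> nat \<times> nat" where
  "entry t = (if t = siggers_left (t ! 0) (t ! 0) (t ! 0) then (0, code t)
     else if t = siggers_left (t ! 0) (t ! 1) (t ! 3) then (2, code t)
     else if t = siggers_right (t ! 1) (t ! 0) (t ! 2) then (3, code (siggers_left (t ! 1) (t ! 0) (t ! 2)))
     else (4, code t))"

definition facts :: "(nat \<times> 'a list list) set" where
  "facts = {(i, ts). i < length (signature C) \<and> ts \<in> rel (power_struct 6 C) i \<and> set ts \<subseteq> T}"

text \<open>Numbers come in blocks of length \<open>B\<close>, with the code as offset. Vertex
  \<open>r\<close> and edge \<open>r\<close> share block \<open>r\<close> without conflict: the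
  former uses codes of left tuples, the latter codes of tuples of neither shape. Constant tuples are
  in block 0.\<close>

definition instance_struct :: "nat \<Rightarrow> (nat \<times> nat) list \<Rightarrow> nat rel_struct" where
  "instance_struct N E = \<lparr>universe = {..<N}, signature = signature C,
     rel = (\<lambda>i. {map (\<lambda>t. entry_value B e (entry t)) ts | e ts.
        e \<in> set (List.enumerate 0 E) \<and> (i, ts) \<in> facts})\<rparr>"

section \<open>Numbers of the variables of the instance\<close>

lemma finite_T: "finite T"
  unfolding T_def using D(1) by (rule finite_tuples)

lemma bij_code: "bij_betw code T {..<B}"
  unfolding code_def B_def
  using someI_ex[OF ex_bij_betw_finite_nat[OF finite_T]] by (simp add: atLeast0LessThan)

lemma code_less: "t \<in> T \<Longrightarrow> code t < B"
  using bij_code by (auto simp: bij_betw_def)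

lemma decode_code: "t \<in> T \<Longrightarrow> decode (code t) = t"
  using bij_code by (simp add: decode_def bij_betw_def)

lemma B_pos: "0 < B"
proof -
  obtain x where "x \<in> D" using D(2) by blast
  then have "siggers_left x x x \<in> T" by (auto simp: T_def tuples_def)
  then show ?thesis using code_less by fastforce
qed

lemma decode_T: "c < B \<Longrightarrow> decode c \<in> T"
  using bij_code by (auto simp: decode_def bij_betw_def intro: inv_into_into)

lemma siggers_T:
  assumes "x \<in> D" "y \<in> D" "z \<in> D"
  shows "siggers_left x y z \<in> T" and "siggers_right x y z \<in> T"
  using assms by (auto simp: T_def tuples_def)

lemma T_nth: "t \<in> T \<Longrightarrow> j < 6 \<Longrightarrow> t ! j \<in> D"
  by (auto simp: T_def tuples_def subset_eq)

lemma entry_bounds: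
  assumes "t \<in> T"
  shows "fst (entry t) \<in> {0, 2, 3, 4}" and "snd (entry t) < B"
proof -
  have "siggers_left (t ! 1) (t ! 0) (t ! 2) \<in> T"
    using assms by (intro siggers_T T_nth) auto
  from code_less[OF this] code_less[OF assms]
  show "fst (entry t) \<in> {0, 2, 3, 4}" "snd (entry t) < B"
    unfolding entry_def by (simp_all only: fst_conv snd_conv insert_iff simp_thms split: if_split)
qed

lemma finite_facts: "finite facts"
proof -
  have "facts \<subseteq> {..<length (signature C)} \<times> (\<Union>k\<in>set (signature C). tuples k T)"
    by (auto simp: facts_def power_struct_def tuples_def)
  then show ?thesis
    by (rule finite_subset) (auto intro: finite_tuples finite_T)
qed

lemma in_enumerate_0: "(k, u, v) \<in> set (List.enumerate 0 E) \<longleftrightarrow> k < length E \<and> E ! k = (u, v)"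
  by (auto simp: in_set_enumerate_eq)

lemma entry_value_less:
  assumes t: "t \<in> T" and e: "e \<in> set (List.enumerate 0 E)" and E: "set E \<subseteq> {..<m} \<times> {..<m}"
    and m: "length E \<le> m"
  shows "entry_value B e (entry t) < B * m"
proof -
  obtain k u v where kuv: "e = (k, u, v)" by (metis prod_cases3)
  then have "k < length E" "(u, v) \<in> set E" using e unfolding kuv in_enumerate_0 by (metis nth_mem)+
  then have "k < m" "u < m" "v < m" using E m by auto
  define r where "r = (let j = fst (entry t) in if j = 0 then 0 else if j = 2 then u else if j = 3 then v else k)"
  have r: "r < m" "entry_value B e (entry t) = B * r + snd (entry t)"
    using \<open>k < m\<close> \<open>u < m\<close> \<open>v < m\<close> by (simp_all add: r_def kuv Let_def entry_value.simps[of B k u v "fst (entry t)" "snd (entry t)", unfolded prod.collapse] del: entry_value.simps)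
  have "B * r + snd (entry t) < B * Suc r" using entry_bounds(2)[OF t] by simp
  also have "\<dots> \<le> B * m" using r(1) by (intro mult_le_mono2) simp
  finally show ?thesis using r(2) by simp
qed

lemma rel_structure_instance:
  assumes "set E \<subseteq> {..<m} \<times> {..<m}" and "length E \<le> m"
  shows "rel_structure (instance_struct (B * m) E)"
  unfolding rel_structure_def
proof (intro conjI allI impI subsetI)
  fix i t
  assume "t \<in> rel (instance_struct (B * m) E) i"
  then obtain e ts where e: "e \<in> set (List.enumerate 0 E)" "(i, ts) \<in> facts"
    "t = map (\<lambda>t. entry_value B e (entry t)) ts"
    by (auto simp: instance_struct_def)
  then have "length ts = signature C ! i" "set ts \<subseteq> T"
    by (auto simp: facts_def power_struct_def tuples_def)
  then show "t \<in> tuples (signature (instance_struct (B * m) E) ! i) (universe (instance_struct (B * m) E))"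
    using e(1,3) entry_value_less[OF _ e(1) assms] by (auto simp: tuples_def instance_struct_def)
qed (simp add: instance_struct_def)

text \<open>The projections agree on shared variables: coordinate \<open>J k\<close> of a left tuple
  is entry \<open>c u\<close> of the triple, and of a right tuple entry \<open>c v\<close>. So the
  value of a vertex variable depends on the colour of the vertex and not on the edge.\<close>

lemma hom_of_colouring:
  assumes E: "set E \<subseteq> {..<n} \<times> {..<n}" and m: "length E \<le> m" "n \<le> m"
    and c: "\<And>u. u < n \<Longrightarrow> c u < (3::nat)" and col: "\<And>u v. (u, v) \<in> set E \<Longrightarrow> c u \<noteq> c v"
  shows "homs (instance_struct (B * m) E) C \<noteq> {}"
proof -
  have "\<forall>k<length E. \<exists>j<6. \<forall>x y z :: 'a. siggers_left x y z ! j = [x, y, z] ! c (fst (E ! k)) \<and>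
      siggers_right x y z ! j = [x, y, z] ! c (snd (E ! k))"
  proof (intro allI impI)
    fix k assume "k < length E"
    then have "E ! k \<in> set E" by simp
    then show "\<exists>j<6. \<forall>x y z :: 'a. siggers_left x y z ! j = [x, y, z] ! c (fst (E ! k)) \<and>
      siggers_right x y z ! j = [x, y, z] ! c (snd (E ! k))"
      using E c col[of "fst (E ! k)" "snd (E ! k)"] by (intro siggers_coordinate) auto
  qed
  then obtain J where J: "\<And>k. k < length E \<Longrightarrow> J k < 6"
    and Jl: "\<And>k x y z. k < length E \<Longrightarrow> siggers_left (x::'a) y z ! J k = [x, y, z] ! c (fst (E ! k))"
    and Jr: "\<And>k x y z. k < length E \<Longrightarrow> siggers_right (x::'a) y z ! J k = [x, y, z] ! c (snd (E ! k))"
    by metis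
  \<comment> \<open>The fallback \<open>t ! 0\<close> gives the padding elements a value in
    \<open>D\<close>, as \<open>m\<close> may exceed \<open>n\<close> and
    \<open>length E\<close>.\<close>
  define val where "val r t =
    (if t = siggers_left (t ! 0) (t ! 0) (t ! 0) then t ! 0
     else if t = siggers_left (t ! 0) (t ! 1) (t ! 3)
       then if r < n then [t ! 0, t ! 1, t ! 3] ! c r else t ! 0
     else if r < length E then t ! J r else t ! 0)" for r and t :: "'a list"
  define h where "h i = val (i div B) (decode (i mod B))" for i
  have h_code: "h (B * r + code t) = val r t" if "t \<in> T" for r t
    using code_less[OF that] decode_code[OF that] by (simp add: h_def)
  have three: "[x, y, z] ! p \<in> D" if "p < 3" "x \<in> D" "y \<in> D" "z \<in> D" for x y z :: 'a and p :: nat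
    using that by (auto simp: less_Suc_eq numeral_3_eq_3)
  have "val r t \<in> D" if t: "t \<in> T" for r t
  proof -
    have "t ! 0 \<in> D" "t ! 1 \<in> D" "t ! 3 \<in> D" using T_nth[OF t] by simp_all
    moreover have "[t ! 0, t ! 1, t ! 3] ! c r \<in> D" if "r < n"
      using calculation by (intro three c that)
    moreover have "t ! J r \<in> D" if "r < length E" using T_nth[OF t J[OF that]] .
    ultimately show ?thesis unfolding val_def by (simp only: simp_thms split: if_split) blast
  qed
  then have h_D: "h i \<in> D" for i
    using decode_T B_pos by (simp add: h_def)
  have h_entry: "h (entry_value B (k, u, v) (entry t)) = t ! J k"
    if t: "t \<in> T" and k: "k < length E" "E ! k = (u, v)" for k u v t
  proof -
    have uv: "u < n" "v < n" using E k by (metis in_mono mem_Sigma_iff lessThan_iff nth_mem)+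
    consider (const) "t = siggers_left (t ! 0) (t ! 0) (t ! 0)"
      | (left) "t \<noteq> siggers_left (t ! 0) (t ! 0) (t ! 0)" "t = siggers_left (t ! 0) (t ! 1) (t ! 3)"
      | (right) "t \<noteq> siggers_left (t ! 0) (t ! 0) (t ! 0)" "t \<noteq> siggers_left (t ! 0) (t ! 1) (t ! 3)"
          "t = siggers_right (t ! 1) (t ! 0) (t ! 2)"
      | (other) "t \<noteq> siggers_left (t ! 0) (t ! 0) (t ! 0)" "t \<noteq> siggers_left (t ! 0) (t ! 1) (t ! 3)"
          "t \<noteq> siggers_right (t ! 1) (t ! 0) (t ! 2)"
      by blast
    then show ?thesis
    proof cases
      case const
      then have "h (entry_value B (k, u, v) (entry t)) = t ! 0"
        using h_code[OF t, of 0] by (simp add: entry_def val_def)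
      moreover have "[x, x, x] ! c u = x" for x :: 'a
        using c[OF uv(1)] by (auto simp: less_Suc_eq numeral_3_eq_3)
      then have "t ! J k = t ! 0" using const Jl[OF k(1), of "t ! 0" "t ! 0" "t ! 0"] k by simp
      ultimately show ?thesis by simp
    next
      case left
      then have "entry t = (2, code t)" by (simp add: entry_def)
      then have "h (entry_value B (k, u, v) (entry t)) = [t ! 0, t ! 1, t ! 3] ! c u"
        using left h_code[OF t, of u] uv by (simp add: val_def)
      moreover have "t ! J k = [t ! 0, t ! 1, t ! 3] ! c u"
        using left Jl[OF k(1), of "t ! 0" "t ! 1" "t ! 3"] k by simp
      ultimately show ?thesis by simp
    next
      case right
      let ?s = "siggers_left (t ! 1) (t ! 0) (t ! 2)"
      have "?s \<noteq> siggers_left (?s ! 0) (?s ! 0) (?s ! 0)"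
        using right by auto
      moreover have "?s = siggers_left (?s ! 0) (?s ! 1) (?s ! 3)" by simp
      ultimately have "val v ?s = [t ! 1, t ! 0, t ! 2] ! c v"
        using uv by (auto simp: val_def)
      moreover have "entry t = (3, code ?s)" using right by (simp add: entry_def)
      moreover have "?s \<in> T" using t by (intro siggers_T T_nth) auto
      ultimately have "h (entry_value B (k, u, v) (entry t)) = [t ! 1, t ! 0, t ! 2] ! c v"
        using h_code[of ?s v] by simp
      moreover have "t ! J k = [t ! 1, t ! 0, t ! 2] ! c v"
        using arg_cong[OF right(3), of "\<lambda>s. s ! J k"]
        by (simp only: Jr[OF k(1)] k(2) snd_conv)
      ultimately show ?thesis by simp
    next
      case other
      then have "entry t = (4, code t)" by (simp add: entry_def)
      then show ?thesis using other h_code[OF t, of k] k(1) by (simp add: val_def)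
    qed
  qed
  let ?Y = "instance_struct (B * m) E"
  have "map (restrict h {..<B * m}) t \<in> rel C i" if t: "t \<in> rel ?Y i" for i t
  proof -
    obtain k u v ts where e: "(k, u, v) \<in> set (List.enumerate 0 E)" "(i, ts) \<in> facts"
      "t = map (\<lambda>t. entry_value B (k, u, v) (entry t)) ts"
      using t by (auto simp: instance_struct_def)
    have k: "k < length E" "E ! k = (u, v)" using e(1) by (auto simp: in_enumerate_0)
    have ts: "set ts \<subseteq> T" "map (\<lambda>t. t ! J k) ts \<in> rel C i"
      using e(2) J[OF k(1)] by (auto simp: facts_def power_struct_def)
    have "restrict h {..<B * m} (entry_value B (k, u, v) (entry t)) = t ! J k" if "t \<in> set ts" for t
    proof -
      have "set E \<subseteq> {..<m} \<times> {..<m}" using E m by force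
      then show ?thesis
        using entry_value_less[of t "(k, u, v)" E m] that ts(1) e(1) m h_entry[OF _ k, of t]
        by (auto simp del: entry_value.simps)
    qed
    then have "map (restrict h {..<B * m}) t = map (\<lambda>t. t ! J k) ts"
      unfolding e(3) by (simp del: entry_value.simps)
    then show ?thesis using ts(2) by simp
  qed
  then have "restrict h {..<B * m} \<in> homs ?Y C"
    using h_D D(3) by (auto simp: homs_def instance_struct_def)
  then show ?thesis by blast
qed

section \<open>From homomorphisms back to colourings\<close>

lemma entry_siggers_left:
  "entry (siggers_left x y z) = (if x = y \<and> y = z then 0 else 2, code (siggers_left x y z))"
  by (auto simp: entry_def)

text \<open>A tuple of both shapes is constant, so the tests in \<open>entry\<close> tell the sides
  apart. The code is that of the left tuple: a vertex has the same variable for a triple whether it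
  is the first or the second end of an edge.\<close>

lemma entry_siggers_right:
  "entry (siggers_right x y z) = (if x = y \<and> y = z then 0 else 3, code (siggers_left x y z))"
  by (auto simp: entry_def)

text \<open>A fixed order of the triples turns the values at a vertex into a tuple, whose orbit can
  serve as colour.\<close>

definition triples :: "('a \<times> 'a \<times> 'a) list" where
  "triples = (SOME l. set l = D \<times> D \<times> D)"

lemma set_triples: "set triples = D \<times> D \<times> D"
  unfolding triples_def using D(1) by (intro someI_ex[OF finite_list]) simp

lemma colouring_of_hom:
  assumes G: "subgroup G (BijGroup (universe C))" and nloc: "\<not> local_siggers C G D"
    and olig: "oligomorphic (universe C) G"
    and E: "set E \<subseteq> {..<n} \<times> {..<n}" and m: "length E \<le> m" "n \<le> m"
    and h: "h \<in> homs (instance_struct (B * m) E) C"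
    and l: "card {{map g t | g. g \<in> G} | t. t \<in> tuples (length triples) (universe C)} \<le> l"
  shows "\<exists>c. (\<forall>u<n. c u < l) \<and> (\<forall>(u, v)\<in>set E. c u \<noteq> c v)"
proof -
  interpret perm_group "universe C" G using G by (rule perm_group.intro)
  have Em: "set E \<subseteq> {..<m} \<times> {..<m}" using E m by force
  let ?k = "length triples"
  let ?O = "{{map g t | g. g \<in> G} | t. t \<in> tuples ?k (universe C)}"
  define var where "var u x y z = B * (if x = y \<and> y = z then 0 else u) + code (siggers_left x y z)" for u x y z
  define tup where "tup u = map (\<lambda>(x, y, z). h (var u x y z)) triples" for u
  define orb where "orb u = {map g (tup u) | g. g \<in> G}" for u
  have hU: "h i \<in> universe C" if "i < B * m" for i
    using h that by (auto simp: homs_def instance_struct_def)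
  have h_rel: "map h t \<in> rel C i" if "i < length (signature C)" "t \<in> rel (instance_struct (B * m) E) i" for i t
    using h that by (simp add: homs_def instance_struct_def)
  have var_less: "var u x y z < B * m" if "u < n" "x \<in> D" "y \<in> D" "z \<in> D" for u x y z
  proof -
    define r where "r = (if x = y \<and> y = z then 0 else u)"
    have "r < m" using that m by (simp add: r_def)
    have "var u x y z < B * Suc r"
      using code_less[OF siggers_T(1)[OF that(2-4)]] by (simp add: var_def r_def)
    also have "\<dots> \<le> B * m" using \<open>r < m\<close> by (intro mult_le_mono2) simp
    finally show ?thesis .
  qed
  have tup: "tup u \<in> tuples ?k (universe C)" if "u < n" for u
    using that hU var_less set_triples by (auto simp: tuples_def tup_def)
  \<comment> \<open>\<open>oligomorphic\<close> speaks of tuples of positive length, so a triple has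
    to exist.\<close>
  obtain x where "x \<in> D" using D(2) by blast
  then have "(x, x, x) \<in> set triples" by (simp add: set_triples)
  then have "1 \<le> ?k" by (cases triples) auto
  then have "finite ?O" using olig unfolding oligomorphic_def by (elim allE impE)
  then obtain idx where idx: "inj_on idx ?O" "idx ` ?O \<subseteq> {..<card ?O}"
    by (metis (no_types, lifting) ex_bij_betw_finite_nat atLeast0LessThan bij_betw_def order_refl)
  have orb: "orb u \<in> ?O" if "u < n" for u using tup[OF that] by (auto simp: orb_def)
  have orb_neq: "orb u \<noteq> orb v" if uv: "(u, v) \<in> set E" for u v
  proof
    assume eq: "orb u = orb v"
    obtain k where k: "k < length E" "E ! k = (u, v)" using uv by (auto simp: in_set_conv_nth)
    have uvn: "u < n" "v < n" using E uv by auto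
    \<comment> \<open>Read on the copy belonging to edge \<open>k\<close>, the homomorphism is a
      partial polymorphism on \<open>D\<close>; equal orbits at the ends make it one that
      \<open>nloc\<close> excludes.\<close>
    define f where "f t = h (entry_value B (k, u, v) (entry t))" for t
    have e: "(k, u, v) \<in> set (List.enumerate 0 E)" using k by (simp add: in_enumerate_0)
    have "f t \<in> universe C" if "t \<in> T" for t
      using hU entry_value_less[OF that e Em m(1)] by (simp add: f_def)
    moreover have "map f ts \<in> rel C i"
      if "i < length (signature C)" "ts \<in> rel (power_struct 6 C) i" "set ts \<subseteq> T" for i ts
    proof -
      have "map (\<lambda>t. entry_value B (k, u, v) (entry t)) ts \<in> rel (instance_struct (B * m) E) i"
        using that e by (auto simp: instance_struct_def facts_def)
      then have "map h (map (\<lambda>t. entry_value B (k, u, v) (entry t)) ts) \<in> rel C i"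
        using h_rel that(1) by blast
      then show ?thesis by (simp add: f_def[abs_def] comp_def)
    qed
    moreover have "tup u \<in> orb v" using eq orbit_mem[OF tup[OF uvn(1)]] by (simp add: orb_def)
    then obtain g where g: "g \<in> G" "tup u = map g (tup v)" by (auto simp: orb_def)
    have "f (siggers_left x y z) = g (f (siggers_right x y z))" if "x \<in> D" "y \<in> D" "z \<in> D" for x y z
    proof -
      have "(x, y, z) \<in> set triples" using that set_triples by simp
      then have "h (var u x y z) = g (h (var v x y z))"
        using g(2) by (auto simp: tup_def)
      then show ?thesis
        by (auto simp: f_def var_def entry_siggers_left entry_siggers_right split: if_splits)
    qed
    ultimately have "local_siggers C G D"
      using g(1) unfolding local_siggers_def T_def by (intro bexI[of _ f]) auto
    then show False using nloc by simp
  qed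
  have "idx (orb u) \<noteq> idx (orb v)" if "(u, v) \<in> set E" for u v
  proof
    assume "idx (orb u) = idx (orb v)"
    moreover have "u < n" "v < n" using that E by auto
    ultimately have "orb u = orb v" using inj_onD[OF idx(1) _ orb orb] by simp
    then show False using orb_neq[OF that] by simp
  qed
  moreover have "idx (orb u) < l" if "u < n" for u
  proof -
    have "idx (orb u) < card ?O"
      using subsetD[OF idx(2) imageI[OF orb[OF that]]] by (simp only: lessThan_iff)
    then show ?thesis using l by (rule less_le_trans)
  qed
  ultimately show ?thesis by (intro exI[of _ "\<lambda>u. idx (orb u)"]) auto
qed

end


section \<open>The reduction\<close>

text \<open>\<open>E\<close> is a list rather than a set: it keeps the order and the repetitions of
  the word, since the index of an edge is its position there.\<close>

lemma encodes_digraph: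
  assumes "encodes w X" and "signature X = [2]"
  obtains n E where "universe X = {..<n}" and "set E \<subseteq> {..<n} \<times> {..<n}"
    and "rel X 0 = (\<lambda>(u, v). [u, v]) ` set E" and "w = nat_word n @ concat (map edge_word E)"
proof -
  obtain n fs where X: "rel_structure X" "universe X = {..<n}"
    and fs: "set fs = {(i, t). i < length (signature X) \<and> t \<in> rel X i}"
    and w: "w = nat_word n @ concat (map fact_word fs)"
    using assms(1) unfolding encodes_def by blast
  have rel: "rel X 0 \<subseteq> tuples 2 {..<n}"
    using X assms(2) by (simp add: rel_structure_def)
  define E where "E = map (\<lambda>(i, t). (t ! 0, t ! 1)) fs"
  have f: "i = 0 \<and> t = [t ! 0, t ! 1] \<and> t \<in> rel X 0 \<and> t ! 0 < n \<and> t ! 1 < n" if "(i, t) \<in> set fs" for i t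
  proof -
    have it: "i = 0" "t \<in> rel X 0" using that fs assms(2) by auto
    then have "length t = 2" "set t \<subseteq> {..<n}" using rel by (auto simp: tuples_def)
    then obtain u v where "t = [u, v]" "u < n" "v < n"
      by (cases t; cases "tl t") auto
    then show ?thesis using it by simp
  qed
  have "edge_word (t ! 0, t ! 1) = fact_word (i, t)" if "(i, t) \<in> set fs" for i t
    using f[OF that] by auto
  then have "map fact_word fs = map edge_word E"
    by (auto simp: E_def)
  moreover have "set E \<subseteq> {..<n} \<times> {..<n}" using f by (auto simp: E_def)
  moreover have "rel X 0 = (\<lambda>(u, v). [u, v]) ` set E"
  proof
    show "rel X 0 \<subseteq> (\<lambda>(u, v). [u, v]) ` set E"
    proof
      fix t assume "t \<in> rel X 0"
      then have t: "(0, t) \<in> set fs" using fs assms(2) by simp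
      then have "(t ! 0, t ! 1) \<in> set E" by (force simp: E_def)
      moreover have "t = (\<lambda>(u, v). [u, v]) (t ! 0, t ! 1)" using f[OF t] by (simp only: case_prod_conv)
      ultimately show "t \<in> (\<lambda>(u, v). [u, v]) ` set E" by (rule rev_image_eqI)
    qed
    have "[t ! 0, t ! 1] \<in> rel X 0" if "(i, t) \<in> set fs" for i t
      using f[OF that] by metis
    then show "(\<lambda>(u, v). [u, v]) ` set E \<subseteq> rel X 0"
      by (auto simp: E_def)
  qed
  ultimately show thesis using that X(2) w by simp
qed

lemma homs_K_iff:
  assumes "universe X = {..<n}" and "signature X = [2]" and "rel X 0 = (\<lambda>(u, v). [u, v]) ` set E"
    and "set E \<subseteq> {..<n} \<times> {..<n}"
  shows "homs X (K l) \<noteq> {} \<longleftrightarrow> (\<exists>c. (\<forall>u<n. c u < l) \<and> (\<forall>(u, v)\<in>set E. c u \<noteq> c v))"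
proof
  assume "homs X (K l) \<noteq> {}"
  then obtain c where c: "c \<in> homs X (K l)" by blast
  have "c u \<noteq> c v" if "(u, v) \<in> set E" for u v
  proof -
    have "[u, v] \<in> rel X 0" using that assms(3) by auto
    then have "map c [u, v] \<in> rel (K l) 0" using c assms(2) by (auto simp: homs_def)
    then show ?thesis by (auto simp: K_def)
  qed
  moreover have "c u < l" if "u < n" for u using c that assms(1) by (auto simp: homs_def K_def)
  ultimately show "\<exists>c. (\<forall>u<n. c u < l) \<and> (\<forall>(u, v)\<in>set E. c u \<noteq> c v)" by blast
next
  assume "\<exists>c. (\<forall>u<n. c u < l) \<and> (\<forall>(u, v)\<in>set E. c u \<noteq> c v)"
  then obtain c where c: "\<And>u. u < n \<Longrightarrow> c u < l" "\<And>u v. (u, v) \<in> set E \<Longrightarrow> c u \<noteq> c v" by blast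
  have "restrict c {..<n} \<in> homs X (K l)"
    using c assms by (fastforce simp: homs_def K_def)
  then show "homs X (K l) \<noteq> {}" by blast
qed

theorem theorem5:
  fixes C :: "'a rel_struct" and G :: "('a \<Rightarrow> 'a) set"
  assumes "\<forall>l\<ge>3. NP_hard (PCSP (K 3) (K l))"
    and "rel_structure C"
    and "subgroup G (BijGroup (universe C))" and "G \<subseteq> Aut C"
    and "oligomorphic (universe C) G"
    and "\<not> siggers_modulo C (pointwise_closure (universe C) G)"
  shows "NP_hard (CSP C)"
proof -
  obtain D where fin: "finite D" "D \<subseteq> universe C" and nloc: "\<not> local_siggers C G D"
    using siggers_modulo_compact[OF assms(2-5)] assms(6) by blast
  \<comment> \<open>Over the empty set only the empty tuple has to be preserved, and it lies in a
    relation of \<open>C\<close> because its projections do.\<close>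
  have "D \<noteq> {}"
  proof
    assume "D = {}"
    have "map f ts \<in> rel C i" if "ts \<in> rel (power_struct 6 C) i" "set ts \<subseteq> tuples 6 {}" for f i ts
    proof -
      have "ts = []" using that(2) by (cases ts) (auto simp: tuples_def)
      moreover have "\<forall>j<6. map (\<lambda>t. t ! j) ts \<in> rel C i" using that(1) by (simp add: power_struct_def)
      from this[rule_format, of 0] have "map (\<lambda>t. t ! 0) ts \<in> rel C i" by simp
      ultimately show ?thesis by simp
    qed
    moreover obtain g where "g \<in> G" using perm_group.ident[OF perm_group.intro[OF assms(3)]] by blast
    ultimately have "local_siggers C G {}"
      unfolding local_siggers_def by (intro bexI[of _ "\<lambda>_. undefined"]) (auto simp: tuples_def)
    then show False using nloc \<open>D = {}\<close> by simp
  qed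
  then interpret siggers_gadget C D using fin by unfold_locales
  \<comment> \<open>The maximum makes the hardness hypothesis applicable; a colouring with fewer
    colours is also one with \<open>l\<close>.\<close>
  define l where "l = max 3 (card {{map g t | g. g \<in> G} | t. t \<in> tuples (length triples) (universe C)})"
  obtain fl where fl: "set fl = facts" using finite_list[OF finite_facts] by blast
  let ?F = "map (\<lambda>(i, ts). (i, map entry ts)) fl"
  have "\<forall>(i, xs)\<in>set ?F. fst ` set xs \<subseteq> {0, 2, 3, 4}"
  proof -
    have F: "fst ` set (map entry ts) \<subseteq> {0, 2, 3, 4}" if "(i, ts) \<in> facts" for i ts
    proof -
      have "set ts \<subseteq> T" using that by (simp add: facts_def)
      show ?thesis
      proof
        fix j assume "j \<in> fst ` set (map entry ts)"
        then obtain t where t: "t \<in> set ts" "j = fst (entry t)" by auto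
        with \<open>set ts \<subseteq> T\<close> have "t \<in> T" by blast
        then show "j \<in> {0, 2, 3, 4}" unfolding t(2) by (rule entry_bounds)
      qed
    qed
    show ?thesis
    proof
      fix x assume "x \<in> set ?F"
      then obtain i ts where "(i, ts) \<in> facts" "x = (i, map entry ts)" using fl by auto
      then show "case x of (i, xs) \<Rightarrow> fst ` set xs \<subseteq> {0, 2, 3, 4}"
        using F by (simp only: prod.case)
    qed
  qed
  from template_reduction[OF this, where B = B] obtain f where f: "poly_time f"
    and f_word: "\<And>w n E. w = nat_word n @ concat (map edge_word E) \<Longrightarrow>
      f w = nat_word (B * length w) @ concat (map fact_word (template_facts B ?F E))" by blast
  \<comment> \<open>Every vertex and every fact takes at least one bit of \<open>w\<close>, so
    \<open>length w\<close> bounds both numbers and serves as \<open>m\<close>.\<close>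
  have encodes_f: "encodes (f w) (instance_struct (B * length w) E)" and bounds: "n \<le> length w" "length E \<le> length w"
    if w: "w = nat_word n @ concat (map edge_word E)" and E: "set E \<subseteq> {..<n} \<times> {..<n}" for w n E
  proof -
    show n: "n \<le> length w" using w by (simp add: nat_word_def)
    have "length E \<le> length (concat (map edge_word E))"
      by (induction E) (auto simp: fact_word_def nat_word_def)
    then show len: "length E \<le> length w" using w by simp
    have "set (template_facts B ?F E) =
      {(i, t). i < length (signature C) \<and> t \<in> rel (instance_struct (B * length w) E) i}"
      (is "?L = ?R")
    proof (intro subset_antisym subsetI)
      fix x assume "x \<in> ?L"
      then obtain e i ts where "e \<in> set (List.enumerate 0 E)" "(i, ts) \<in> facts"
        "x = (i, map (\<lambda>t. entry_value B e (entry t)) ts)"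
        by (auto simp: template_facts_def fl comp_def)
      then show "x \<in> ?R" by (auto simp: instance_struct_def facts_def simp del: split_paired_Ex)
    next
      fix x assume "x \<in> ?R"
      then obtain e i ts where "e \<in> set (List.enumerate 0 E)" "(i, ts) \<in> facts"
        "x = (i, map (\<lambda>t. entry_value B e (entry t)) ts)"
        by (auto simp: instance_struct_def)
      then show "x \<in> ?L" by (force simp: template_facts_def fl comp_def)
    qed
    moreover have "set E \<subseteq> {..<length w} \<times> {..<length w}" using E n by force
    then have "rel_structure (instance_struct (B * length w) E)"
      using len by (rule rel_structure_instance)
    ultimately show "encodes (f w) (instance_struct (B * length w) E)"
      unfolding encodes_def f_word[OF w]
      by (intro conjI exI[of _ "B * length w"] exI[of _ "template_facts B ?F E"])
        (simp_all add: instance_struct_def)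
  qed
  have sig: "signature (instance_struct N E) = signature C" for N E
    by (simp add: instance_struct_def)
  show ?thesis
  proof (rule NP_hard_reduction)
    show "NP_hard (PCSP (K 3) (K l))" using assms(1) by (simp add: l_def)
    show "poly_time f" by (rule f)
  next
    fix w assume "w \<in> fst (PCSP (K 3) (K l))"
    then obtain X where X: "encodes w X" "signature X = [2]" "homs X (K 3) \<noteq> {}"
      by (auto simp: PCSP_def K_def)
    from encodes_digraph[OF X(1,2)] obtain n E where E: "universe X = {..<n}" "set E \<subseteq> {..<n} \<times> {..<n}"
      "rel X 0 = (\<lambda>(u, v). [u, v]) ` set E" "w = nat_word n @ concat (map edge_word E)" by metis
    obtain c where "\<forall>u<n. c u < (3 :: nat)" "\<forall>(u, v)\<in>set E. c u \<noteq> c v"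
      using iffD1[OF homs_K_iff[OF E(1) X(2) E(3,2)] X(3)] by blast
    then have "homs (instance_struct (B * length w) E) C \<noteq> {}"
      using bounds[OF E(4,2)] by (intro hom_of_colouring[OF E(2), where c = c]) auto
    then show "f w \<in> fst (CSP C)"
      using encodes_f[OF E(4,2)] sig unfolding CSP_def PCSP_def by auto
  next
    fix w assume "w \<in> snd (PCSP (K 3) (K l))"
    then obtain X where X: "encodes w X" "signature X = [2]" "homs X (K l) = {}"
      by (auto simp: PCSP_def K_def)
    from encodes_digraph[OF X(1,2)] obtain n E where E: "universe X = {..<n}" "set E \<subseteq> {..<n} \<times> {..<n}"
      "rel X 0 = (\<lambda>(u, v). [u, v]) ` set E" "w = nat_word n @ concat (map edge_word E)" by metis
    have "h \<notin> homs (instance_struct (B * length w) E) C" for h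
    proof
      assume "h \<in> homs (instance_struct (B * length w) E) C"
      from colouring_of_hom[OF assms(3) nloc assms(5) E(2) bounds(2,1)[OF E(4,2)] this, of l]
      have "homs X (K l) \<noteq> {}"
        by (intro iffD2[OF homs_K_iff[OF E(1) X(2) E(3,2)]]) (simp add: l_def)
      then show False using X(3) by simp
    qed
    then show "f w \<in> snd (CSP C)"
      using encodes_f[OF E(4,2)] sig unfolding CSP_def PCSP_def by auto
  qed
qed

end
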